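(* For every $n\geq 1$ there exists a bijection $\Psi:\mathcal{B}_n\to\mathcal{O}_n$ such that for every $\pi\in\mathcal{B}_n$, $$\mathsf{des}(\pi)=\widetilde{\mathsf{exc}}(\Psi(\pi))\qquad\text{and}\qquad \mathrm{PEAK}(\pi)=\mathsf{cPEAK}(\Psi(\pi)).$$ In particular $\sum_{\pi\in\mathcal{B}_n}t^{\mathsf{des}(\pi)}=\sum_{\sigma\in\mathcal{O}_n}t^{\widetilde{\mathsf{exc}}(\sigma)}$.
   Context: $\mathfrak{S}_n$ is the set of permutations of $[n]=\{1,\dots,n\}$, written in one-line notation $\pi=\pi_1\cdots\pi_n$ with $\pi_i=\pi(i)$, or as a product of disjoint cycles. $\mathsf{asc}(\pi)=|\{i\in[n-1]:\pi_i<\pi_{i+1}\}|$, $\mathsf{des}(\pi)=|\{i\in[n-1]:\pi_i>\pi_{i+1}\}|$. A ballot permutation is a $\pi\in\mathfrak{S}_n$ such that every prefix $\pi_1\cdots\pi_i$ has at most as many descents as ascents; $\mathcal{B}_n$ is the set of ballot permutations in $\mathfrak{S}_n$. $\mathcal{O}_n$ is the set of permutations in $\mathfrak{S}_n$ all of whose cycles have odd length. For a cycle $C=(c_1c_2\cdots c_k)$, $\mathsf{casc}(C)=|\{i\in[k]:c_i<c_{i+1}\}|$ with $c_{k+1}=c_1$, and $\mathsf{cdes}(C)=k-\mathsf{casc}(C)$; $\widetilde{\mathsf{exc}}(\sigma)=\sum_C\min(\mathsf{casc}(C),\mathsf{cdes}(C))$, summed over all cycles $C$ of $\sigma$ (including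 fixed points). A value $k$ is a peak of $\pi$ if $1<\pi^{-1}(k)=\ell<n$ and $\pi(\ell-1)<k>\pi(\ell+1)$; then $\pi(\ell-1),\pi(\ell+1)$ are its neighbors. A value $k$ is a cyclic peak of $\sigma$ if $\sigma^{-1}(k)<k>\sigma(k)$; its cyclic neighbors are $\sigma^{-1}(k)$ and $\sigma(k)$. $\mathrm{PEAK}(\pi)$ is the set of pairs $(b,\{a,c\})$ with $b$ a peak of $\pi$ and $a,c$ its neighbors; $\mathsf{cPEAK}(\sigma)$ is the set of pairs $(b,\{a,c\})$ with $b$ a cyclic peak of $\sigma$ and $a,c$ its cyclic neighbors. *)

theory Defs
  imports "HOL-Combinatorics.Permutations"
begin

definition perms :: "nat \<Rightarrow> (nat \<Rightarrow> nat) set" where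
  "perms n = {p. p permutes {1..n}}"

definition asc :: "nat \<Rightarrow> (nat \<Rightarrow> nat) \<Rightarrow> nat" where
  "asc n p = card {i \<in> {1..<n}. p i < p (Suc i)}"

definition des :: "nat \<Rightarrow> (nat \<Rightarrow> nat) \<Rightarrow> nat" where
  "des n p = card {i \<in> {1..<n}. p i > p (Suc i)}"

definition ballot :: "nat \<Rightarrow> (nat \<Rightarrow> nat) set" where
  "ballot n = {p \<in> perms n. \<forall>m \<in> {1..n}. des m p \<le> asc m p}"

definition cycle_of :: "(nat \<Rightarrow> nat) \<Rightarrow> nat \<Rightarrow> nat set" where
  "cycle_of s x = {(s ^^ k) x | k. True}"

definition cycles :: "nat \<Rightarrow> (nat \<Rightarrow> nat) \<Rightarrow> nat set set" where
  "cycles n s = cycle_of s ` {1..n}"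

definition odd_perms :: "nat \<Rightarrow> (nat \<Rightarrow> nat) set" where
  "odd_perms n = {s \<in> perms n. \<forall>C \<in> cycles n s. odd (card C)}"

definition casc :: "(nat \<Rightarrow> nat) \<Rightarrow> nat set \<Rightarrow> nat" where
  "casc s C = card {c \<in> C. c < s c}"

definition cdes :: "(nat \<Rightarrow> nat) \<Rightarrow> nat set \<Rightarrow> nat" where
  "cdes s C = card C - casc s C"

definition exc_tilde :: "nat \<Rightarrow> (nat \<Rightarrow> nat) \<Rightarrow> nat" where
  "exc_tilde n s = (\<Sum>C \<in> cycles n s. min (casc s C) (cdes s C))"

definition PEAK :: "nat \<Rightarrow> (nat \<Rightarrow> nat) \<Rightarrow> (nat \<times> nat set) set" where
  "PEAK n p = {(p l, {p (l - 1), p (Suc l)}) | l. 1 < l \<and> l < n \<and>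
                 p (l - 1) < p l \<and> p l > p (Suc l)}"

definition cPEAK :: "nat \<Rightarrow> (nat \<Rightarrow> nat) \<Rightarrow> (nat \<times> nat set) set" where
  "cPEAK n s = {(k, {inv s k, s k}) | k. k \<in> {1..n} \<and> inv s k < k \<and> k > s k}"

end

theory Submission
  imports Defs "HOL-Combinatorics.Cycles" "HOL-Computational_Algebra.Polynomial"
begin

text \<open>
  Inclusion-exclusion over sets of peaks reduces the claim to counting words and permutations in which a
  prescribed set of letters are peaks with prescribed neighbors. Weight a word \<open>w\<close> by
  \<open>q\<close> to the power asc - des. The decisive fact is that for an adjacent pair of letters the
  weights of an ascent and of a descent add up to \<open>c = q + 1/q\<close>, whatever the letters are:
  inserting a factor \<open>c\<close> replaces an edge by a cut, and the marked peaks with their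
  neighbors form blocks of height zero that are never cut. Let \<open>W(S)\<close> be \<open>c\<close>
  times the weighted sum of all words on \<open>S\<close> (with \<open>W({}) = 1\<close>).

  Cutting a word just after its last minimum or just before its first minimum, and reversing the left
  part, gives \<open>W = B(1/q) * B(q)\<close> under subset convolution, where \<open>B\<close>
  enumerates ballot words by asc - des + 1. On the other hand an alternating sum over cuts, in which
  words of even length cancel by reversal, shows that \<open>W\<close> enumerates permutations with odd
  cycles, each cycle having weight \<open>q^s + q^-s\<close> for \<open>s = casc - cdes\<close>. Hence
  \<open>W = O(1/q) * O(q)\<close>, where \<open>O\<close> enumerates these permutations by the sum of
  \<open>|casc - cdes|\<close> over the cycles. Both \<open>B\<close> and \<open>O\<close> involve only
  positive powers of \<open>q\<close> on nonempty sets, so they agree by induction on \<open>S\<close>.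
\<close>

section \<open>Heights of words\<close>

text \<open>A tie counts as a descent, in agreement with \<open>casc\<close>. It matters for fixed
  points, read as the closed word \<open>[a, a]\<close> of height -1.\<close>

definition step :: "nat \<Rightarrow> nat \<Rightarrow> int" where
  "step x y = (if x < y then 1 else -1)"

fun ht :: "nat list \<Rightarrow> int" where
  "ht (x # y # w) = step x y + ht (y # w)"
| "ht w = 0"

lemma ht_Cons: "w \<noteq> [] \<Longrightarrow> ht (x # w) = step x (hd w) + ht w"
  by (cases w) auto

lemma ht_append: "u \<noteq> [] \<Longrightarrow> v \<noteq> [] \<Longrightarrow> ht (u @ v) = ht u + step (last u) (hd v) + ht v"
  by (induction u rule: ht.induct) (auto simp: ht_Cons)

lemma ht_join: "ht (u @ a # v) = ht (u @ [a]) + ht (a # v)"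
  by (cases "u = []") (auto simp: ht_append)

text \<open>Reversal swaps ascents and descents; a tie would count as -1 in both directions.\<close>

lemma ht_rev: "distinct w \<Longrightarrow> ht (rev w) = - ht w"
proof (induction w rule: ht.induct)
  case (1 x y w)
  have "ht (rev (x # y # w)) = ht (rev (y # w)) + step y x"
    using ht_append[of "rev (y # w)" "[x]"] by simp
  then show ?case using 1 by (auto simp: step_def)
qed auto

definition weight_sum :: "real \<Rightarrow> real" where
  "weight_sum q = q + inverse q"

lemma weight_sum_step: "weight_sum q = q powi step x y + q powi (- step x y)"
  by (auto simp: weight_sum_def step_def power_int_minus)

lemma finite_distinct_lists [simp]: "finite {w. distinct w \<and> set w = S \<and> P w}"
proof (cases "finite S")
  case True
  show ?thesis by (rule finite_subset[OF _ finite_subset_distinct[OF True]]) auto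
next
  case False
  then have "{w. distinct w \<and> set w = S \<and> P w} = {}" by auto
  then show ?thesis by (metis finite.emptyI)
qed

section \<open>Words with marked peaks\<close>

text \<open>The letters of \<open>K\<close> are the marked peaks, and \<open>N b\<close> is the neighbor set prescribed for \<open>b\<close>.\<close>

locale marked_peaks =
  fixes K :: "nat set" and N :: "nat \<Rightarrow> nat set"
begin

text \<open>Every occurrence of a marked letter must be an interior peak with the prescribed
  neighbors. Marked letters that do not occur impose nothing, so the same predicate serves all
  subsets of the alphabet.\<close>

definition good :: "nat list \<Rightarrow> bool" where
  "good w \<longleftrightarrow> (\<forall>xs b ys. w = xs @ b # ys \<longrightarrow> b \<in> K \<longrightarrow>
     xs \<noteq> [] \<and> ys \<noteq> [] \<and> last xs < b \<and> hd ys < b \<and> N b = {last xs, hd ys})"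

lemma goodD:
  assumes "good (xs @ b # ys)" "b \<in> K"
  shows "xs \<noteq> []" "ys \<noteq> []" "last xs < b" "hd ys < b" "N b = {last xs, hd ys}"
  using assms unfolding good_def by blast+

lemma good_ends:
  assumes "good w" "w \<noteq> []"
  shows "hd w \<notin> K" "last w \<notin> K"
proof -
  show "hd w \<notin> K" using goodD(1)[of "[]" "hd w" "tl w"] assms by auto
  show "last w \<notin> K" using goodD(2)[of "butlast w" "last w" "[]"] assms by auto
qed

lemma good_rev_imp: "good w \<Longrightarrow> good (rev w)"
  unfolding good_def
proof (intro allI impI)
  fix xs b ys
  assume g: "\<forall>xs b ys. w = xs @ b # ys \<longrightarrow> b \<in> K \<longrightarrow>
     xs \<noteq> [] \<and> ys \<noteq> [] \<and> last xs < b \<and> hd ys < b \<and> N b = {last xs, hd ys}"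
    and w: "rev w = xs @ b # ys" and b: "b \<in> K"
  have "w = rev ys @ b # rev xs" using arg_cong[OF w, of rev] by simp
  with g b have "rev ys \<noteq> [] \<and> rev xs \<noteq> [] \<and> last (rev ys) < b \<and> hd (rev xs) < b \<and>
      N b = {last (rev ys), hd (rev xs)}" by blast
  then show "xs \<noteq> [] \<and> ys \<noteq> [] \<and> last xs < b \<and> hd ys < b \<and> N b = {last xs, hd ys}"
    by (auto simp: hd_rev last_rev)
qed

lemma good_rev: "good (rev w) \<longleftrightarrow> good w"
  using good_rev_imp[of w] good_rev_imp[of "rev w"] by auto

text \<open>A cut removes a neighbor only from the two letters next to it; a marked one would become
  an end of its piece, where it cannot be a peak.\<close>

lemma good_append_iff:
  assumes "u \<noteq> []" "v \<noteq> []"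
  shows "good u \<and> good v \<longleftrightarrow> good (u @ v) \<and> last u \<notin> K \<and> hd v \<notin> K"
proof safe
  assume g: "good u" "good v"
  show "good (u @ v)" unfolding good_def
  proof (intro allI impI)
    fix xs b ys assume e: "u @ v = xs @ b # ys" and b: "b \<in> K"
    then consider us where "u = xs @ b # us" "ys = us @ v"
      | us where "xs = u @ us" "v = us @ b # ys"
      by (auto simp: append_eq_append_conv2 append_eq_Cons_conv Cons_eq_append_conv)
    then show "xs \<noteq> [] \<and> ys \<noteq> [] \<and> last xs < b \<and> hd ys < b \<and> N b = {last xs, hd ys}"
    proof cases
      case 1 then show ?thesis using goodD[of xs b us] g b by auto
    next
      case 2 then show ?thesis using goodD[of us b ys] g b by auto
    qed
  qed
next
  assume "good u" "good v" "last u \<in> K" then show False using good_ends assms by blast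
next
  assume "good u" "good v" "hd v \<in> K" then show False using good_ends assms by blast
next
  assume g: "good (u @ v)" "last u \<notin> K" "hd v \<notin> K"
  show "good u" unfolding good_def
  proof (intro allI impI)
    fix xs b ys assume e: "u = xs @ b # ys" and b: "b \<in> K"
    then have "ys \<noteq> []" using g by auto
    then show "xs \<noteq> [] \<and> ys \<noteq> [] \<and> last xs < b \<and> hd ys < b \<and> N b = {last xs, hd ys}"
      using goodD[of xs b "ys @ v"] g b e by auto
  qed
  show "good v" unfolding good_def
  proof (intro allI impI)
    fix xs b ys assume e: "v = xs @ b # ys" and b: "b \<in> K"
    then have "xs \<noteq> []" using g by auto
    then show "xs \<noteq> [] \<and> ys \<noteq> [] \<and> last xs < b \<and> hd ys < b \<and> N b = {last xs, hd ys}"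
      using goodD[of "u @ xs" b "ys"] g b e by auto
  qed
qed

text \<open>An unmarked \<open>a\<close> carries no condition of its own, and its copy in both
  pieces preserves the neighbors of all other letters.\<close>

lemma good_join:
  assumes "a \<notin> K"
  shows "good (u @ a # v) \<longleftrightarrow> good (u @ [a]) \<and> good (a # v)"
proof safe
  assume g: "good (u @ a # v)"
  show "good (u @ [a])" unfolding good_def
  proof (intro allI impI)
    fix xs b ys assume e: "u @ [a] = xs @ b # ys" and b: "b \<in> K"
    then have y: "ys \<noteq> []" using assms by auto
    have "u @ a # v = xs @ b # ys @ v" using arg_cong[OF e, of "\<lambda>l. l @ v"] by simp
    with g have "good (xs @ b # ys @ v)" by metis
    from goodD[OF this b] y
    show "xs \<noteq> [] \<and> ys \<noteq> [] \<and> last xs < b \<and> hd ys < b \<and> N b = {last xs, hd ys}"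
      by auto
  qed
  show "good (a # v)" unfolding good_def
  proof (intro allI impI)
    fix xs b ys assume e: "a # v = xs @ b # ys" and b: "b \<in> K"
    then have y: "xs \<noteq> []" using assms by auto
    have "u @ a # v = (u @ xs) @ b # ys" using e by simp
    then show "xs \<noteq> [] \<and> ys \<noteq> [] \<and> last xs < b \<and> hd ys < b \<and> N b = {last xs, hd ys}"
      using goodD[of "u @ xs" b "ys"] g b e y by auto
  qed
next
  assume g: "good (u @ [a])" "good (a # v)"
  show "good (u @ a # v)" unfolding good_def
  proof (intro allI impI)
    fix xs b ys assume e: "u @ a # v = xs @ b # ys" and b: "b \<in> K"
    then have "b \<noteq> a" using assms by auto
    with e consider us where "u = xs @ b # us" "ys = us @ a # v"
      | us where "xs = u @ a # us" "v = us @ b # ys"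
      by (auto simp: append_eq_append_conv2 append_eq_Cons_conv Cons_eq_append_conv)
    then show "xs \<noteq> [] \<and> ys \<noteq> [] \<and> last xs < b \<and> hd ys < b \<and> N b = {last xs, hd ys}"
    proof cases
      case 1 then show ?thesis using goodD[of xs b "us @ [a]"] g b
        by (cases us) auto
    next
      case 2 then show ?thesis using goodD[of "a # us" b ys] g b by auto
    qed
  qed
qed

section \<open>Admissible cuts and the alternating telescoping sum\<close>

definition cuts :: "nat list \<Rightarrow> (nat list \<times> nat list) set" where
  "cuts w = {(u, v). u @ v = w \<and> u \<noteq> [] \<and> v \<noteq> [] \<and> last u \<notin> K \<and> hd v \<notin> K}"

lemma finite_cuts [simp]: "finite (cuts w)"
proof -
  have "cuts w \<subseteq> (\<lambda>i. (take i w, drop i w)) ` {..length w}"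
  proof
    fix z assume "z \<in> cuts w"
    then have "z = (take (length (fst z)) w, drop (length (fst z)) w)" "length (fst z) \<le> length w"
      by (auto simp: cuts_def)
    then show "z \<in> (\<lambda>i. (take i w, drop i w)) ` {..length w}" by blast
  qed
  then show ?thesis by (rule finite_subset) auto
qed

lemma cuts_Cons:
  assumes "a \<notin> K" "b \<notin> K"
  shows "cuts (a # b # r) = insert ([a], b # r) ((\<lambda>(x, y). (a # x, y)) ` cuts (b # r))"
    (is "?l = ?r")
proof
  show "?l \<subseteq> ?r"
  proof
    fix z assume z: "z \<in> ?l"
    obtain x y where xy: "z = (x, y)" by force
    then obtain x' where "x = a # x'" using z by (cases x) (auto simp: cuts_def)
    then show "z \<in> ?r" using z xy by (cases x') (auto simp: cuts_def)
  qed
  show "?r \<subseteq> ?l" using assms by (auto simp: cuts_def)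
qed

text \<open>Both cuts next to the marked \<open>b\<close> are forbidden, so the first possible cut
  lies after \<open>d\<close>.\<close>

lemma cuts_Cons_peak:
  assumes "b \<in> K"
  shows "cuts (a # b # d # r) = (\<lambda>(x, y). (a # b # x, y)) ` cuts (d # r)" (is "?l = ?r")
proof
  show "?l \<subseteq> ?r"
  proof
    fix z assume z: "z \<in> ?l"
    obtain x y where xy: "z = (x, y)" by force
    then obtain x' where x': "x = a # x'" using z by (cases x) (auto simp: cuts_def)
    then obtain x'' where "x' = b # x''" using z xy assms by (cases x') (auto simp: cuts_def)
    then show "z \<in> ?r" using z xy x' assms by (cases x'') (auto simp: cuts_def)
  qed
  show "?r \<subseteq> ?l" using assms by (auto simp: cuts_def)
qed

text \<open>By \<open>weight_sum_step\<close>, \<open>weight_sum q\<close> times a cut term splits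
  into two powers of \<open>q\<close>: steps before the cut count with sign +, steps after it with
  sign -, and the step at the cut with either sign. Consecutive cuts share one of these powers with
  opposite coefficients, so only the two ends survive. A marked peak has height zero, and passing
  over it adds two letters, so it changes neither exponent nor sign.\<close>

lemma cut_telescope:
  fixes q :: real
  assumes "q \<noteq> 0" "good v" "v \<noteq> []"
  shows "q powi (- ht v) + (-1) ^ length v * q powi (ht v) =
    - weight_sum q * (\<Sum>(x, y)\<in>cuts v. (-1) ^ length x * q powi (ht x - ht y))"
  using assms(2,3)
proof (induction "length v" arbitrary: v rule: less_induct)
  case less
  let ?f = "\<lambda>(x, y). (-1) ^ length x * q powi (ht x - ht y)"
  obtain a v' where v: "v = a # v'" using less.prems by (cases v) auto
  have a: "a \<notin> K" using good_ends less.prems v by fastforce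
  show ?case
  proof (cases v')
    case Nil
    have "cuts [a] = {}" by (auto simp: cuts_def append_eq_Cons_conv)
    then show ?thesis by (simp add: v Nil)
  next
    case (Cons b r)
    show ?thesis
    proof (cases "b \<in> K")
      case False
      define h where "h = ht (b # r)"
      define s where "s = step a b"
      define e :: real where "e = (-1) ^ length (b # r)"
      have g: "good (b # r)"
        using good_append_iff[of "[a]" "b # r"] less.prems False a v Cons by auto
      have IH: "q powi (- h) + e * q powi h = - weight_sum q * sum ?f (cuts (b # r))"
        unfolding h_def e_def using less.hyps[of "b # r"] g v Cons by auto
      have notin: "([a], b # r) \<notin> (\<lambda>(x, y). (a # x, y)) ` cuts (b # r)"
        by (auto simp: cuts_def)
      have inj: "inj_on (\<lambda>(x, y). (a # x, y)) (cuts (b # r))" by (auto simp: inj_on_def)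
      \<comment> \<open>Prepending \<open>a\<close> flips the sign of every old cut term and
        multiplies it by \<open>q powi s\<close>.\<close>
      have im: "sum ?f ((\<lambda>(x, y). (a # x, y)) ` cuts (b # r)) = - (q powi s) * sum ?f (cuts (b # r))"
        unfolding sum.reindex[OF inj] sum_distrib_left
      proof (rule sum.cong[OF refl])
        fix z assume z: "z \<in> cuts (b # r)"
        obtain x y where xy: "z = (x, y)" by force
        then obtain x' where x': "x = b # x'" using z by (cases x) (auto simp: cuts_def)
        have "ht (a # x) - ht y = s + (ht x - ht y)" by (simp add: x' s_def)
        then have "q powi (ht (a # x) - ht y) = q powi s * q powi (ht x - ht y)"
          by (metis assms(1) power_int_add)
        then show "(?f \<circ> (\<lambda>(x, y). (a # x, y))) z = - (q powi s) * ?f z"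
          by (simp add: xy)
      qed
      have "sum ?f (cuts v) = ?f ([a], b # r) - (q powi s) * sum ?f (cuts (b # r))"
        unfolding v Cons cuts_Cons[OF a False] by (subst sum.insert) (use notin im in auto)
      also have "?f ([a], b # r) = - (q powi (- h))" by (simp add: h_def)
      finally have S: "sum ?f (cuts v) = - (q powi (- h)) - (q powi s) * sum ?f (cuts (b # r))" .
      have "- weight_sum q * sum ?f (cuts v) =
          weight_sum q * q powi (- h) + q powi s * (weight_sum q * sum ?f (cuts (b # r)))"
        unfolding S by (simp add: algebra_simps)
      also have "weight_sum q * sum ?f (cuts (b # r)) = - (q powi (- h) + e * q powi h)"
        using IH by simp
      \<comment> \<open>Writing \<open>weight_sum q\<close> as
        \<open>q powi s + q powi (- s)\<close> cancels \<open>q powi s * q powi (- h)\<close>; this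
        is the telescoping.\<close>
      also have "weight_sum q * q powi (- h) + q powi s * (- (q powi (- h) + e * q powi h)) =
          q powi (- s) * q powi (- h) - e * (q powi s * q powi h)"
        using weight_sum_step[of q a b] unfolding s_def[symmetric] by (simp add: algebra_simps)
      also have "\<dots> = q powi (- ht v) + (-1) ^ length v * q powi (ht v)"
      proof -
        have hv: "ht v = s + h" by (simp add: v Cons s_def h_def)
        have "q powi (- ht v) = q powi (- s) * q powi (- h)"
          "q powi (ht v) = q powi s * q powi h"
          using assms(1) power_int_add[of q "-s" "-h"] power_int_add[of q s h] by (auto simp: hv)
        then show ?thesis by (simp add: e_def v Cons)
      qed
      finally show ?thesis by simp
    next
      case True
      have e: "v = [a] @ b # r" by (simp add: v Cons)
      note G = goodD[OF less.prems(1)[unfolded e] True]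
      obtain d r' where r: "r = d # r'" using G by (cases r) auto
      have bd: "a < b" "d < b" using G r by auto
      \<comment> \<open>Adjacent letters cannot both be marked, since each would have to exceed the
        other.\<close>
      have d: "d \<notin> K"
      proof
        assume "d \<in> K"
        then have "b < d" using goodD(3)[of "[a, b]" d r'] less.prems v Cons r by auto
        then show False using bd by simp
      qed
      have g: "good (d # r')"
        using good_join[of d "[a, b]" r'] d less.prems v Cons r by auto
      have IH: "q powi (- ht (d # r')) + (-1) ^ length (d # r') * q powi (ht (d # r'))
          = - weight_sum q * sum ?f (cuts (d # r'))"
        using less.hyps[of "d # r'"] g v Cons r by auto
      have hv: "ht v = ht (d # r')" using bd by (simp add: v Cons r step_def)
      have inj: "inj_on (\<lambda>(x, y). (a # b # x, y)) (cuts (d # r'))" by (auto simp: inj_on_def)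
      have "sum ?f (cuts v) = sum ?f (cuts (d # r'))"
        unfolding v Cons r cuts_Cons_peak[OF True] sum.reindex[OF inj]
      proof (rule sum.cong[OF refl])
        fix z assume z: "z \<in> cuts (d # r')"
        obtain x y where xy: "z = (x, y)" by force
        then obtain x' where x': "x = d # x'" using z by (cases x) (auto simp: cuts_def)
        then show "(?f \<circ> (\<lambda>(x, y). (a # b # x, y))) z = ?f z"
          using bd by (simp add: xy step_def)
      qed
      then show ?thesis using IH unfolding hv by (simp add: v Cons r)
    qed
  qed
qed


section \<open>Generating sums of words, pointed words and rings\<close>

definition words :: "nat set \<Rightarrow> nat list set" where
  "words S = {w. distinct w \<and> set w = S \<and> good w}"

lemma finite_words [simp]: "finite (words S)"
  by (simp add: words_def)

lemma sum_words_rev: "(\<Sum>w\<in>words S. f (rev w)) = (\<Sum>w\<in>words S. f w)"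
  by (rule sum.reindex_bij_witness[of _ rev rev]) (auto simp: words_def good_rev)

definition word_sum :: "real \<Rightarrow> nat set \<Rightarrow> real" where
  "word_sum q S = (if S = {} then 1 else weight_sum q * (\<Sum>w\<in>words S. q powi ht w))"

lemma word_sum_rev:
  "word_sum q S = (if S = {} then 1 else weight_sum q * (\<Sum>w\<in>words S. q powi (- ht w)))"
proof -
  have "(\<Sum>w\<in>words S. q powi (- ht w)) = (\<Sum>w\<in>words S. q powi (ht (rev w)))"
    by (rule sum.cong) (auto simp: words_def ht_rev)
  then show ?thesis by (simp add: word_sum_def sum_words_rev[of "\<lambda>w. q powi ht w"])
qed

text \<open>
  A pair \<open>(v, u)\<close> stands both for the word \<open>u a v\<close>, split at \<open>a\<close>, and for the cycle \<open>(a v u)\<close>,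
  cut between \<open>v\<close> and \<open>u\<close>.
\<close>

definition pointed :: "nat \<Rightarrow> nat set \<Rightarrow> (nat list \<times> nat list) set" where
  "pointed a S = {(v, u). distinct (a # v @ u) \<and> set (a # v @ u) = S \<and> good (a # v) \<and> good (u @ [a])}"

text \<open>The exponent is that of \<open>cut_telescope\<close> for the closed word
  \<open>a v u a\<close> cut between \<open>v\<close> and \<open>u\<close>. The sign differs from
  the one there by a factor -1, because the leading \<open>a\<close> is not counted.\<close>

definition pointed_sum :: "real \<Rightarrow> nat \<Rightarrow> nat set \<Rightarrow> real" where
  "pointed_sum q a S =
     (\<Sum>(v, u)\<in>pointed a S. (-1) ^ length v * q powi (ht (a # v) - ht (u @ [a])))"

lemma finite_pointed [simp]: "finite (pointed a S)"
proof (cases "finite S")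
  case True
  have "pointed a S \<subseteq> {w. set w \<subseteq> S \<and> distinct w} \<times> {w. set w \<subseteq> S \<and> distinct w}"
    by (auto simp: pointed_def)
  then show ?thesis by (rule finite_subset) (simp add: finite_subset_distinct True)
next
  case False
  then have "pointed a S = {}" by (auto simp: pointed_def)
  then show ?thesis by simp
qed

text \<open>Exchanging and reversing the two pieces fixes the exponent. For even
  \<open>card S\<close> the lengths of \<open>v\<close> and \<open>u\<close> have opposite parity,
  so the sign flips.\<close>

lemma pointed_sum_even:
  assumes "finite S" "even (card S)" "a \<in> S"
  shows "pointed_sum q a S = 0"
proof -
  let ?f = "\<lambda>(v, u). (-1) ^ length v * q powi (ht (a # v) - ht (u @ [a]))"
  have "sum ?f (pointed a S) = (\<Sum>z\<in>pointed a S. - ?f z)"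
  proof (rule sum.reindex_bij_witness[of _ "\<lambda>(v, u). (rev u, rev v)" "\<lambda>(v, u). (rev u, rev v)"])
    fix z assume z: "z \<in> pointed a S"
    obtain v u where vu: "z = (v, u)" by force
    have d: "distinct (a # v @ u)" "set (a # v @ u) = S" "good (a # v)" "good (u @ [a])"
      using z vu by (auto simp: pointed_def)
    have c: "card S = Suc (length v + length u)"
      using d(1) distinct_card[OF d(1)] unfolding d(2) by simp
    have h: "ht (a # rev u) = - ht (u @ [a])" "ht (rev v @ [a]) = - ht (a # v)"
      using ht_rev[of "u @ [a]"] ht_rev[of "a # v"] d(1) by auto
    have "even (length v) \<longleftrightarrow> odd (length u)" using c assms(2) by simp
    then have "(-1::real) ^ length u = - ((-1) ^ length v)"
      by (cases "even (length u)") auto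
    then show "- ?f ((\<lambda>(v, u). (rev u, rev v)) z) = ?f z" using h by (simp add: vu)
    have "good (a # rev u)" "good (rev v @ [a])"
      using good_rev[of "u @ [a]"] good_rev[of "a # v"] d by auto
    then show "(\<lambda>(v, u). (rev u, rev v)) z \<in> pointed a S"
      using d by (auto simp: vu pointed_def)
    then show "(\<lambda>(v, u). (rev u, rev v)) z \<in> pointed a S" .
  qed auto
  then show ?thesis by (simp add: pointed_sum_def sum_negf)
qed

text \<open>Write a word as \<open>u a v\<close> and apply \<open>cut_telescope\<close> to
  \<open>a v\<close> only. The uncut term is a pointed pair on all of \<open>S\<close>. A cut of
  \<open>a v\<close> into \<open>a x\<close> and \<open>y\<close> leaves the pointed pair
  \<open>(x, u)\<close> on a set \<open>T\<close> and an arbitrary word \<open>y\<close> on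
  \<open>S - T\<close>, whose sum absorbs the factor \<open>weight_sum q\<close>.\<close>

lemma word_sum_pointed:
  assumes "q \<noteq> 0" "finite S" "a \<in> S" "a \<notin> K"
  shows "(\<Sum>w\<in>words S. q powi (- ht w)) =
    (\<Sum>T | T \<subseteq> S \<and> a \<in> T. pointed_sum q a T * word_sum q (S - T))"
proof -
  let ?g = "\<lambda>(v, u) y. (-1) ^ length v * q powi (ht (a # v) - ht (u @ [a])) * q powi (- ht y)"
  have inj: "inj_on (\<lambda>(v, u). u @ a # v) (pointed a S)"
    by (auto simp: inj_on_def pointed_def append_Cons_eq_iff)
  have im: "words S = (\<lambda>(v, u). u @ a # v) ` pointed a S"
  proof
    show "words S \<subseteq> (\<lambda>(v, u). u @ a # v) ` pointed a S"
    proof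
      fix w assume w: "w \<in> words S"
      then have "a \<in> set w" using assms by (auto simp: words_def)
      then obtain u v where uv: "w = u @ a # v" by (meson split_list)
      have "good (u @ [a])" "good (a # v)"
        using w good_join[OF assms(4), of u v] unfolding uv words_def by auto
      then have "(v, u) \<in> pointed a S" using w by (auto simp: pointed_def words_def uv)
      then show "w \<in> (\<lambda>(v, u). u @ a # v) ` pointed a S" using uv by force
    qed
    show "(\<lambda>(v, u). u @ a # v) ` pointed a S \<subseteq> words S"
    proof clarify
      fix v u assume p: "(v, u) \<in> pointed a S"
      then have "good (u @ a # v)" using good_join[OF assms(4), of u v] by (auto simp: pointed_def)
      then show "u @ a # v \<in> words S" using p by (auto simp: pointed_def words_def)
    qed
  qed
  have tel: "q powi (- ht (u @ a # v)) =
      (-1) ^ length v * q powi (ht (a # v) - ht (u @ [a])) +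
      weight_sum q * (\<Sum>(x, y)\<in>cuts (a # v). ?g (tl x, u) y)" if p: "(v, u) \<in> pointed a S" for v u
  proof -
    have "q powi (- ht (a # v)) = (-1) ^ length v * q powi (ht (a # v)) +
        weight_sum q * - (\<Sum>(x, y)\<in>cuts (a # v). (-1) ^ length x * q powi (ht x - ht y))"
      using cut_telescope[OF assms(1), of "a # v"] p by (simp add: pointed_def)
    also have "- (\<Sum>(x, y)\<in>cuts (a # v). (-1) ^ length x * q powi (ht x - ht y)) =
        (\<Sum>(x, y)\<in>cuts (a # v). (-1) ^ length (tl x) * q powi (ht (a # tl x) - ht y))"
      unfolding sum_negf[symmetric]
    proof (rule sum.cong[OF refl], clarify)
      fix x y assume "(x, y) \<in> cuts (a # v)"
      then obtain x' where "x = a # x'" by (cases x) (auto simp: cuts_def)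
      then show "- ((-1) ^ length x * q powi (ht x - ht y)) =
          (-1) ^ length (tl x) * q powi (ht (a # tl x) - ht y)" by simp
    qed
    finally have "q powi (- ht (a # v)) = (-1) ^ length v * q powi (ht (a # v)) + weight_sum q *
        (\<Sum>(x, y)\<in>cuts (a # v). (-1) ^ length (tl x) * q powi (ht (a # tl x) - ht y))" .
    moreover have "q powi (- ht (u @ a # v)) = q powi (- ht (u @ [a])) * q powi (- ht (a # v))"
      using power_int_add[of q "- ht (u @ [a])" "- ht (a # v)"] assms(1) ht_join[of u a v] by simp
    ultimately have "q powi (- ht (u @ a # v)) =
        q powi (- ht (u @ [a])) * ((-1) ^ length v * q powi (ht (a # v))) + weight_sum q *
        (q powi (- ht (u @ [a])) *
        (\<Sum>(x, y)\<in>cuts (a # v). (-1) ^ length (tl x) * q powi (ht (a # tl x) - ht y)))"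
      by (simp add: algebra_simps)
    moreover have "q powi (- ht (u @ [a])) * q powi (ht (a # v)) = q powi (ht (a # v) - ht (u @ [a]))"
      using assms(1) power_int_add[of q "- ht (u @ [a])" "ht (a # v)"] by simp
    moreover have "q powi (- ht (u @ [a])) *
        (\<Sum>(x, y)\<in>cuts (a # v). (-1) ^ length (tl x) * q powi (ht (a # tl x) - ht y)) =
        (\<Sum>(x, y)\<in>cuts (a # v). ?g (tl x, u) y)"
      unfolding sum_distrib_left
    proof (rule sum.cong[OF refl], clarify)
      fix x y
      have "q powi (- ht (u @ [a])) * q powi (ht (a # tl x) - ht y) =
          q powi (ht (a # tl x) - ht (u @ [a])) * q powi (- ht y)"
        using assms(1) by (simp add: power_int_add[symmetric] algebra_simps)
      then show "q powi (- ht (u @ [a])) * ((-1) ^ length (tl x) * q powi (ht (a # tl x) - ht y)) =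
        (-1) ^ length (tl x) * q powi (ht (a # tl x) - ht (u @ [a])) * q powi (- ht y)"
        by (simp add: algebra_simps)
    qed
    ultimately show ?thesis by (simp add: algebra_simps)
  qed
  let ?T = "{T. T \<subseteq> S \<and> a \<in> T}"
  have fT: "finite ?T" using assms(2) by simp
  have "(\<Sum>w\<in>words S. q powi (- ht w)) = (\<Sum>(v, u)\<in>pointed a S. q powi (- ht (u @ a # v)))"
    unfolding im sum.reindex[OF inj] by (simp add: case_prod_unfold)
  also have "\<dots> = (\<Sum>(v, u)\<in>pointed a S. (-1) ^ length v * q powi (ht (a # v) - ht (u @ [a])) +
      weight_sum q * (\<Sum>(x, y)\<in>cuts (a # v). ?g (tl x, u) y))"
    using tel by (intro sum.cong) auto
  also have "\<dots> = pointed_sum q a S +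
      weight_sum q * (\<Sum>(v, u)\<in>pointed a S. \<Sum>(x, y)\<in>cuts (a # v). ?g (tl x, u) y)"
    by (simp add: pointed_sum_def case_prod_unfold sum.distrib sum_distrib_left)
  also have "(\<Sum>(v, u)\<in>pointed a S. \<Sum>(x, y)\<in>cuts (a # v). ?g (tl x, u) y) =
      (\<Sum>((v, u), (x, y))\<in>Sigma (pointed a S) (\<lambda>(v, u). cuts (a # v)). ?g (tl x, u) y)"
    by (subst sum.Sigma[symmetric]) (auto simp: case_prod_unfold)
  \<comment> \<open>\<open>T\<close> collects the letters of \<open>u\<close> and of the piece
    starting with \<open>a\<close>; it is proper because \<open>y\<close> is nonempty.\<close>
  also have "\<dots> = (\<Sum>(T, z, y)\<in>Sigma (?T - {S}) (\<lambda>T. pointed a T \<times> words (S - T)). ?g z y)"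
  proof (rule sum.reindex_bij_witness
      [of _ "\<lambda>(T, (v, u), y). ((v @ y, u), (a # v, y))"
            "\<lambda>((v, u), (x, y)). (set x \<union> set u, (tl x, u), y)"])
    fix z assume z: "z \<in> Sigma (pointed a S) (\<lambda>(v, u). cuts (a # v))"
    obtain v u x y where e: "z = ((v, u), (x, y))" by (metis prod.exhaust)
    have p: "distinct (a # v @ u)" "set (a # v @ u) = S" "good (a # v)" "good (u @ [a])"
      and c: "(x, y) \<in> cuts (a # v)" using z e by (auto simp: pointed_def)
    obtain x' where x: "x = a # x'" using c by (cases x) (auto simp: cuts_def)
    have v: "v = x' @ y" and y: "y \<noteq> []" using c x by (auto simp: cuts_def)
    have "good (x @ y)" "last x \<notin> K" "hd y \<notin> K" using p(3) c x v by (auto simp: cuts_def)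
    then have g: "good (a # x')" "good y" using good_append_iff[of x y] x y by auto
    have "set x \<union> set u \<noteq> S" using y p x v by (cases y) auto
    moreover have "S - (set x \<union> set u) = set y" using p x v by auto
    ultimately show "(\<lambda>((v, u), (x, y)). (set x \<union> set u, (tl x, u), y)) z \<in>
        Sigma (?T - {S}) (\<lambda>T. pointed a T \<times> words (S - T))"
      using p g by (auto simp: e x v words_def pointed_def)
    show "(\<lambda>(T, (v, u), y). ((v @ y, u), (a # v, y)))
        ((\<lambda>((v, u), (x, y)). (set x \<union> set u, (tl x, u), y)) z) = z"
      by (simp add: e x v)
    show "(\<lambda>(T, z, y). ?g z y) ((\<lambda>((v, u), (x, y)). (set x \<union> set u, (tl x, u), y)) z) =
        (\<lambda>((v, u), (x, y)). ?g (tl x, u) y) z"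
      by (simp add: e)
  next
    fix z assume z: "z \<in> Sigma (?T - {S}) (\<lambda>T. pointed a T \<times> words (S - T))"
    obtain T v u y where e: "z = (T, (v, u), y)" by (metis prod.exhaust)
    have T: "T \<subseteq> S" "T \<noteq> S" "a \<in> T"
      and p: "distinct (a # v @ u)" "set (a # v @ u) = T" "good (a # v)" "good (u @ [a])"
      and y: "distinct y" "set y = S - T" "good y" using z e by (auto simp: pointed_def words_def)
    have y0: "y \<noteq> []" using T y by auto
    have "good (a # v @ y)" "last (a # v) \<notin> K" "hd y \<notin> K"
      using good_append_iff[of "a # v" y] p y y0 by auto
    then show "(\<lambda>(T, (v, u), y). ((v @ y, u), (a # v, y))) z \<in>
        Sigma (pointed a S) (\<lambda>(v, u). cuts (a # v))"
      using T p y y0 by (auto simp: e pointed_def cuts_def)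
    show "(\<lambda>((v, u), (x, y)). (set x \<union> set u, (tl x, u), y))
        ((\<lambda>(T, (v, u), y). ((v @ y, u), (a # v, y))) z) = z"
      using p by (auto simp: e)
  qed
  also have "\<dots> = (\<Sum>T\<in>?T - {S}. \<Sum>(z, y)\<in>pointed a T \<times> words (S - T). ?g z y)"
    using fT by (subst sum.Sigma) auto
  also have "\<dots> = (\<Sum>T\<in>?T - {S}. pointed_sum q a T * (\<Sum>y\<in>words (S - T). q powi (- ht y)))"
    by (rule sum.cong[OF refl])
      (simp add: pointed_sum_def sum_product sum.cartesian_product case_prod_unfold)
  also have "weight_sum q * \<dots> = (\<Sum>T\<in>?T - {S}. pointed_sum q a T * word_sum q (S - T))"
    by (subst sum_distrib_left, rule sum.cong) (auto simp: word_sum_rev mult.left_commute)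
  \<comment> \<open>The uncut term becomes the summand \<open>T = S\<close>, because
    \<open>word_sum q {} = 1\<close>.\<close>
  also have "pointed_sum q a S + \<dots> = (\<Sum>T\<in>?T. pointed_sum q a T * word_sum q (S - T))"
    using fT assms(3) by (subst sum.remove[of ?T S]) (auto simp: word_sum_def)
  finally show ?thesis .
qed

text \<open>
  A ring \<open>r\<close> is the cycle \<open>(a r)\<close>. As \<open>a\<close> is not marked, its cyclic peaks are the peaks of the word
  \<open>a r a\<close>.
\<close>

definition rings :: "nat \<Rightarrow> nat set \<Rightarrow> nat list set" where
  "rings a S = {r. distinct (a # r) \<and> set (a # r) = S \<and> good (a # r @ [a])}"

lemma finite_rings [simp]: "finite (rings a S)"
proof -
  have "rings a S \<subseteq> {w. distinct w \<and> set w = S - {a} \<and> True}"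
    by (auto simp: rings_def)
  then show ?thesis by (rule finite_subset) (rule finite_distinct_lists)
qed

text \<open>For odd \<open>card S\<close> the closed word \<open>a r a\<close> has even length, so
  both ends in \<open>cut_telescope\<close> carry the same sign. Its cuts correspond to the
  splittings of \<open>r\<close> into \<open>v\<close> and \<open>u\<close>.\<close>

lemma ring_sum_pointed:
  assumes "q \<noteq> 0" "odd (card S)" "a \<notin> K"
  shows "(\<Sum>r\<in>rings a S. q powi ht (a # r @ [a]) + q powi (- ht (a # r @ [a]))) =
    weight_sum q * pointed_sum q a S"
proof -
  let ?f = "\<lambda>v u. (-1) ^ length v * q powi (ht (a # v) - ht (u @ [a]))"
  have tel: "q powi ht (a # r @ [a]) + q powi (- ht (a # r @ [a])) =
      weight_sum q * (\<Sum>(x, y)\<in>cuts (a # r @ [a]). ?f (tl x) (butlast y))"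
    if r: "r \<in> rings a S" for r
  proof -
    have "card S = length (a # r)" using r distinct_card[of "a # r"] by (auto simp: rings_def)
    then have "even (length (a # r @ [a]))" using assms(2) by simp
    then have "q powi ht (a # r @ [a]) + q powi (- ht (a # r @ [a])) = weight_sum q *
        - (\<Sum>(x, y)\<in>cuts (a # r @ [a]). (-1) ^ length x * q powi (ht x - ht y))"
      using cut_telescope[OF assms(1), of "a # r @ [a]"] r by (simp add: rings_def)
    also have "- (\<Sum>(x, y)\<in>cuts (a # r @ [a]). (-1) ^ length x * q powi (ht x - ht y)) =
        (\<Sum>(x, y)\<in>cuts (a # r @ [a]). ?f (tl x) (butlast y))"
      unfolding sum_negf[symmetric]
    proof (rule sum.cong[OF refl], clarify)
      fix x y assume c: "(x, y) \<in> cuts (a # r @ [a])"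
      then obtain x' where "x = a # x'" by (cases x) (auto simp: cuts_def)
      moreover obtain y' where "y = y' @ [a]" using c
        by (cases y rule: rev_cases) (auto simp: cuts_def simp flip: append_assoc append_Cons)
      ultimately show "- ((-1) ^ length x * q powi (ht x - ht y)) = ?f (tl x) (butlast y)" by simp
    qed
    finally show ?thesis .
  qed
  have "(\<Sum>r\<in>rings a S. q powi ht (a # r @ [a]) + q powi (- ht (a # r @ [a]))) =
      weight_sum q * (\<Sum>r\<in>rings a S. \<Sum>(x, y)\<in>cuts (a # r @ [a]). ?f (tl x) (butlast y))"
    unfolding sum_distrib_left using tel by (intro sum.cong) (auto simp: sum_distrib_left)
  also have "(\<Sum>r\<in>rings a S. \<Sum>(x, y)\<in>cuts (a # r @ [a]). ?f (tl x) (butlast y)) =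
      (\<Sum>(r, x, y)\<in>Sigma (rings a S) (\<lambda>r. cuts (a # r @ [a])). ?f (tl x) (butlast y))"
    by (subst sum.Sigma) (auto simp: case_prod_unfold)
  also have "\<dots> = pointed_sum q a S"
    unfolding pointed_sum_def
  proof (rule sum.reindex_bij_witness
      [of _ "\<lambda>(v, u). (v @ u, a # v, u @ [a])" "\<lambda>(r, x, y). (tl x, butlast y)"])
    fix z assume z: "z \<in> Sigma (rings a S) (\<lambda>r. cuts (a # r @ [a]))"
    obtain r x y where e: "z = (r, x, y)" by (metis prod.exhaust)
    have r: "distinct (a # r)" "set (a # r) = S" "good (a # r @ [a])"
      and c: "(x, y) \<in> cuts (a # r @ [a])" using z e by (auto simp: rings_def)
    obtain x' where x: "x = a # x'" using c by (cases x) (auto simp: cuts_def)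
    obtain y' where y: "y = y' @ [a]" using c
      by (cases y rule: rev_cases) (auto simp: cuts_def simp flip: append_assoc append_Cons)
    have rr: "r = x' @ y'" using c by (simp add: cuts_def x y)
    have "good (a # x') \<and> good (y' @ [a])"
      using good_append_iff[of "a # x'" "y' @ [a]"] c r by (auto simp: cuts_def x y rr)
    then show "(\<lambda>(r, x, y). (tl x, butlast y)) z \<in> pointed a S"
      using r by (auto simp: e x y rr pointed_def)
    show "(\<lambda>(v, u). (v @ u, a # v, u @ [a])) ((\<lambda>(r, x, y). (tl x, butlast y)) z) = z"
      by (simp add: e x y rr)
    show "(\<lambda>(v, u). ?f v u) ((\<lambda>(r, x, y). (tl x, butlast y)) z) =
        (\<lambda>(r, x, y). ?f (tl x) (butlast y)) z" by (simp add: e)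
  next
    fix z assume z: "z \<in> pointed a S"
    obtain v u where e: "z = (v, u)" by force
    have p: "distinct (a # v @ u)" "set (a # v @ u) = S" "good (a # v)" "good (u @ [a])"
      using z e by (auto simp: pointed_def)
    have "good (a # v @ u @ [a]) \<and> last (a # v) \<notin> K \<and> hd (u @ [a]) \<notin> K"
      using good_append_iff[of "a # v" "u @ [a]"] p by auto
    then show "(\<lambda>(v, u). (v @ u, a # v, u @ [a])) z \<in> Sigma (rings a S) (\<lambda>r. cuts (a # r @ [a]))"
      using p by (auto simp: e rings_def cuts_def)
    show "(\<lambda>(r, x, y). (tl x, butlast y)) ((\<lambda>(v, u). (v @ u, a # v, u @ [a])) z) = z"
      by (simp add: e)
  qed
  finally show ?thesis .
qed

text \<open>Even \<open>T\<close> vanish by \<open>pointed_sum_even\<close>; for odd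
  \<open>T\<close> the pointed sums close up to rings. Thus \<open>word_sum\<close> obeys the
  recursion that splits off the cycle through \<open>a\<close>.\<close>

lemma word_sum_rec:
  assumes "q \<noteq> 0" "finite S" "a \<in> S" "a \<notin> K"
  shows "word_sum q S = (\<Sum>T | T \<subseteq> S \<and> a \<in> T \<and> odd (card T).
    (\<Sum>r\<in>rings a T. q powi ht (a # r @ [a]) + q powi (- ht (a # r @ [a]))) * word_sum q (S - T))"
proof -
  have "word_sum q S = weight_sum q * (\<Sum>w\<in>words S. q powi (- ht w))"
    using assms(3) by (auto simp: word_sum_rev)
  also have "\<dots> = (\<Sum>T | T \<subseteq> S \<and> a \<in> T. weight_sum q * pointed_sum q a T * word_sum q (S - T))"
    by (simp add: word_sum_pointed[OF assms] sum_distrib_left mult.assoc)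
  also have "\<dots> = (\<Sum>T | T \<subseteq> S \<and> a \<in> T \<and> odd (card T).
      weight_sum q * pointed_sum q a T * word_sum q (S - T))"
    using assms(2) by (intro sum.mono_neutral_right) (auto intro: finite_subset pointed_sum_even)
  finally show ?thesis by (simp add: ring_sum_pointed assms)
qed

end

section \<open>Cutting a word at its minima\<close>

text \<open>The ballot condition: the first letter has minimal height, which may be attained again
  later.\<close>

definition starts_min :: "nat list \<Rightarrow> bool" where
  "starts_min w \<longleftrightarrow> (\<forall>u v. w = u @ v \<longrightarrow> u \<noteq> [] \<longrightarrow> 0 \<le> ht u)"

text \<open>The last letter has minimal height: the height of a suffix is the last height minus an
  earlier one.\<close>

definition ends_min :: "nat list \<Rightarrow> bool" where
  "ends_min w \<longleftrightarrow> (\<forall>u v. w = u @ v \<longrightarrow> v \<noteq> [] \<longrightarrow> ht v \<le> 0)"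

lemma starts_min_rev:
  assumes "distinct w"
  shows "starts_min (rev w) \<longleftrightarrow> ends_min w"
proof
  assume s: "starts_min (rev w)"
  show "ends_min w" unfolding ends_min_def
  proof (intro allI impI)
    fix u v assume e: "w = u @ v" and "v \<noteq> []"
    then have "0 \<le> ht (rev v)" using s by (auto simp: starts_min_def)
    then show "ht v \<le> 0" using assms e ht_rev[of v] by simp
  qed
next
  assume s: "ends_min w"
  show "starts_min (rev w)" unfolding starts_min_def
  proof (intro allI impI)
    fix u v assume e: "rev w = u @ v" and u: "u \<noteq> []"
    then have w: "w = rev v @ rev u" by (metis rev_append rev_rev_ident)
    then have "ht (rev u) \<le> 0" using s u by (auto simp: ends_min_def)
    then show "0 \<le> ht u" using assms w ht_rev[of u] by simp
  qed
qed

text \<open>Positions are zero-based and the prefix includes the letter at \<open>i\<close>, hence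
  \<open>Suc i\<close>; the first letter has height 0.\<close>

definition height :: "nat list \<Rightarrow> nat \<Rightarrow> int" where
  "height w i = ht (take (Suc i) w)"

lemma height_Suc: "Suc i < length w \<Longrightarrow> height w (Suc i) = height w i + step (w ! i) (w ! Suc i)"
  using ht_append[of "take (Suc i) w" "[w ! Suc i]"]
  by (simp add: height_def take_Suc_conv_app_nth)

lemma ht_factor:
  assumes "j \<le> i" "i < length w"
  shows "ht (take (Suc i - j) (drop j w)) = height w i - height w j"
proof -
  have a: "take (Suc i) w = take j w @ take (Suc i - j) (drop j w)"
    using assms(1) take_add[of j "Suc i - j" w] by simp
  have b: "take (Suc i - j) (drop j w) = w ! j # take (i - j) (drop (Suc j) w)"
    using assms by (simp add: Cons_nth_drop_Suc[symmetric] Suc_diff_le)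
  have "take (Suc j) w = take j w @ [w ! j]" using assms by (simp add: take_Suc_conv_app_nth)
  then show ?thesis
    using ht_join[of "take j w" "w ! j" "take (i - j) (drop (Suc j) w)"]
    unfolding height_def a b by simp
qed

lemma starts_min_drop:
  assumes "i < length w"
  shows "starts_min (drop i w) \<longleftrightarrow> (\<forall>j. i \<le> j \<longrightarrow> j < length w \<longrightarrow> height w i \<le> height w j)"
proof
  assume s: "starts_min (drop i w)"
  show "\<forall>j. i \<le> j \<longrightarrow> j < length w \<longrightarrow> height w i \<le> height w j"
  proof (intro allI impI)
    fix j assume j: "i \<le> j" "j < length w"
    have "0 \<le> ht (take (Suc j - i) (drop i w))"
      using s append_take_drop_id[of "Suc j - i" "drop i w"] j unfolding starts_min_def
      by (metis Suc_diff_le assms drop_eq_Nil leD nat.distinct(1) take_eq_Nil)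
    then show "height w i \<le> height w j" using ht_factor[OF j] by simp
  qed
next
  assume h: "\<forall>j. i \<le> j \<longrightarrow> j < length w \<longrightarrow> height w i \<le> height w j"
  show "starts_min (drop i w)" unfolding starts_min_def
  proof (intro allI impI)
    fix u v assume e: "drop i w = u @ v" and u: "u \<noteq> []"
    have l: "length w - i = length u + length v" using arg_cong[OF e, of length] by simp
    define j where "j = i + length u - 1"
    have "Suc 0 \<le> length u" using u by (cases u) auto
    then have j: "i \<le> j" "j < length w" and ji: "Suc j - i = length u"
      using l assms unfolding j_def by linarith+
    have u: "u = take (Suc j - i) (drop i w)" unfolding ji using e by simp
    have "height w i \<le> height w j" using h j by blast
    then show "0 \<le> ht u" using ht_factor[OF j] u by simp
  qed
qed

lemma ends_min_take:
  assumes "i < length w"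
  shows "ends_min (take (Suc i) w) \<longleftrightarrow> (\<forall>j\<le>i. height w i \<le> height w j)"
proof
  assume s: "ends_min (take (Suc i) w)"
  show "\<forall>j\<le>i. height w i \<le> height w j"
  proof (intro allI impI)
    fix j assume j: "j \<le> i"
    have "take (Suc i) w = take j w @ take (Suc i - j) (drop j w)"
      using j take_add[of j "Suc i - j" w] by simp
    moreover have "take (Suc i - j) (drop j w) \<noteq> []" using j assms by auto
    ultimately have "ht (take (Suc i - j) (drop j w)) \<le> 0" using s unfolding ends_min_def by blast
    then show "height w i \<le> height w j" using ht_factor[OF j assms] by simp
  qed
next
  assume h: "\<forall>j\<le>i. height w i \<le> height w j"
  show "ends_min (take (Suc i) w)" unfolding ends_min_def
  proof (intro allI impI)
    fix u v assume e: "take (Suc i) w = u @ v" and v: "v \<noteq> []"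
    have l: "Suc i = length u + length v" using arg_cong[OF e, of length] assms by simp
    have "v = drop (length u) (take (Suc i) w)" using e by simp
    moreover have j: "length u \<le> i" using l v by (cases v) auto
    ultimately have "v = take (Suc i - length u) (drop (length u) w)" by (simp add: drop_take)
    moreover have "height w i \<le> height w (length u)" using h j by blast
    ultimately show "ht v \<le> 0" using ht_factor[OF j assms] by simp
  qed
qed

text \<open>An index in the set is a global minimum with everything after it strictly higher, so it
  must be the last minimum \<open>k\<close>. If \<open>k\<close> is not the final point, the path
  must step up after \<open>k\<close>, and then \<open>k\<close> qualifies.\<close>

lemma last_min_unique:
  fixes H :: "nat \<Rightarrow> int"
  assumes "0 < m" and st: "\<And>i. Suc i < m \<Longrightarrow> H (Suc i) = H i + 1 \<or> H (Suc i) = H i - 1"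
  shows "card {i. Suc i < m \<and> (\<forall>j\<le>i. H i \<le> H j) \<and> (\<forall>j. Suc i \<le> j \<longrightarrow> j < m \<longrightarrow> H (Suc i) \<le> H j) \<and>
      H (Suc i) = H i + 1} = (if \<forall>j\<le>m - 1. H (m - 1) \<le> H j then 0 else 1)" (is "card ?A = _")
proof -
  define M where "M = {i. i < m \<and> (\<forall>j<m. H i \<le> H j)}"
  have fin: "finite M" unfolding M_def by simp
  have ne: "M \<noteq> {}"
  proof -
    have "finite (H ` {..<m})" "H ` {..<m} \<noteq> {}" using assms(1) by auto
    from Min_in[OF this] obtain i where "i < m" "H i = Min (H ` {..<m})" by auto
    then have "i \<in> M" by (auto simp: M_def)
    then show ?thesis by auto
  qed
  define k where "k = Max M"
  have k: "k \<in> M" using Max_in[OF fin ne] by (simp add: k_def)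
  have big: "H k < H j" if kj: "k < j" "j < m" for j
  proof -
    have "j \<notin> M" using Max_ge[OF fin, of j] kj unfolding k_def by auto
    then obtain l where l: "l < m" "H l < H j" using kj unfolding M_def by force
    have "H k \<le> H l" using k l(1) by (simp add: M_def)
    then show ?thesis using l(2) by simp
  qed
  have sub: "i = k" if i: "i \<in> ?A" for i
  proof -
    have a: "H i \<le> H j" if "j < m" for j
    proof (cases "j \<le> i")
      case False
      then have "H (Suc i) \<le> H j" using i that by auto
      then show ?thesis using i by auto
    qed (use i in auto)
    then have "i \<in> M" using i by (auto simp: M_def)
    then have "i \<le> k" using Max_ge[OF fin] by (simp add: k_def)
    moreover have "\<not> i < k"
    proof
      assume "i < k"
      then have "H i + 1 \<le> H k" using i k by (auto simp: M_def)
      moreover have "H k \<le> H i" using k i by (auto simp: M_def)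
      ultimately show False by simp
    qed
    ultimately show ?thesis by simp
  qed
  show ?thesis
  proof (cases "\<forall>j\<le>m - 1. H (m - 1) \<le> H j")
    case True
    then have "m - 1 \<in> M" using assms(1) by (auto simp: M_def)
    then have "m - 1 \<le> k" using Max_ge[OF fin] by (simp add: k_def)
    then have "i \<notin> ?A" for i using sub[of i] by auto
    then have e: "?A = {}" by blast
    show ?thesis unfolding e using True by simp
  next
    case False
    then have "k \<noteq> m - 1" using k by (auto simp: M_def)
    then have l: "Suc k < m" using k by (auto simp: M_def)
    then have s: "H (Suc k) = H k + 1" using st[OF l] big[of "Suc k"] by auto
    have "H (Suc k) \<le> H j" if "Suc k \<le> j" "j < m" for j using big[of j] that s by simp
    moreover have "H k \<le> H j" if "j \<le> k" for j using k that by (simp add: M_def)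
    ultimately have "k \<in> ?A" using l s by blast
    then have "?A = {k}" using sub by blast
    then show ?thesis using False by simp
  qed
qed

text \<open>
  A cut through an ascent sits just after the last minimum of the word, a cut through a descent
  just before its first minimum; so each kind occurs at most once.
\<close>

definition min_cuts :: "int \<Rightarrow> nat list \<Rightarrow> (nat list \<times> nat list) set" where
  "min_cuts s w = {(u, v). u @ v = w \<and> u \<noteq> [] \<and> v \<noteq> [] \<and> ends_min u \<and> starts_min v \<and>
     step (last u) (hd v) = s}"

text \<open>The cut after position \<open>i\<close> qualifies exactly when \<open>i\<close> is
  counted by \<open>last_min_unique\<close> for the height function.\<close>

lemma card_min_cuts_up:
  assumes "w \<noteq> []"
  shows "card (min_cuts 1 w) = (if ends_min w then 0 else 1)"
proof -
  let ?H = "height w" and ?m = "length w"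
  let ?A = "{i. Suc i < ?m \<and> (\<forall>j\<le>i. ?H i \<le> ?H j) \<and>
      (\<forall>j. Suc i \<le> j \<longrightarrow> j < ?m \<longrightarrow> ?H (Suc i) \<le> ?H j) \<and> ?H (Suc i) = ?H i + 1}"
  let ?c = "\<lambda>i. (take (Suc i) w, drop (Suc i) w)"
  have c: "?c i \<in> min_cuts 1 w \<longleftrightarrow> i \<in> ?A" if i: "Suc i < ?m" for i
  proof -
    have "last (take (Suc i) w) = w ! i" "hd (drop (Suc i) w) = w ! Suc i"
      using i by (auto simp: take_Suc_conv_app_nth hd_drop_conv_nth)
    moreover have "take (Suc i) w \<noteq> []" "drop (Suc i) w \<noteq> []" using i by auto
    ultimately show ?thesis
      using i ends_min_take[of i w] starts_min_drop[of "Suc i" w] height_Suc[of i w]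
      by (auto simp: min_cuts_def)
  qed
  have "min_cuts 1 w = ?c ` ?A"
  proof
    show "?c ` ?A \<subseteq> min_cuts 1 w" using c by blast
    show "min_cuts 1 w \<subseteq> ?c ` ?A"
    proof
      fix z assume z: "z \<in> min_cuts 1 w"
      obtain u v where uv: "z = (u, v)" by force
      define i where "i = length u - 1"
      have "u @ v = w" "u \<noteq> []" "v \<noteq> []" using z uv by (auto simp: min_cuts_def)
      moreover from this have "Suc i = length u" by (simp add: i_def)
      ultimately have "z = ?c i" "Suc i < ?m" using uv by auto
      then show "z \<in> ?c ` ?A" using c z by blast
    qed
  qed
  moreover have "inj_on ?c ?A"
  proof (rule inj_onI)
    fix i j assume "i \<in> ?A" "j \<in> ?A" "?c i = ?c j"
    then have "length (take (Suc i) w) = length (take (Suc j) w)" by simp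
    then show "i = j" using \<open>i \<in> ?A\<close> \<open>j \<in> ?A\<close> by simp
  qed
  ultimately have "card (min_cuts 1 w) = card ?A" by (simp add: card_image)
  also have "\<dots> = (if \<forall>j\<le>?m - 1. ?H (?m - 1) \<le> ?H j then 0 else 1)"
    by (rule last_min_unique) (use assms in \<open>auto simp: height_Suc step_def\<close>)
  also have "(\<forall>j\<le>?m - 1. ?H (?m - 1) \<le> ?H j) \<longleftrightarrow> ends_min w"
    using ends_min_take[of "?m - 1" w] assms by simp
  finally show ?thesis .
qed

text \<open>Reversal exchanges the two pieces, the two minimality conditions and the direction of
  the step at the cut.\<close>

lemma card_min_cuts_down:
  assumes "w \<noteq> []" "distinct w"
  shows "card (min_cuts (-1) w) = (if starts_min w then 0 else 1)"
proof -
  have "bij_betw (\<lambda>(u, v). (rev v, rev u)) (min_cuts (-1) w) (min_cuts 1 (rev w))"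
  proof (rule bij_betwI[of _ _ _ "\<lambda>(u, v). (rev v, rev u)"])
    have *: "(rev v, rev u) \<in> min_cuts (- s) (rev w)"
      if z: "(u, v) \<in> min_cuts s w" and d: "distinct w" for u v s w
    proof -
      have uv: "u @ v = w" "u \<noteq> []" "v \<noteq> []" "ends_min u" "starts_min v" "step (last u) (hd v) = s"
        using z by (auto simp: min_cuts_def)
      have "last u \<noteq> hd v" using uv d by (cases u rule: rev_cases; cases v) auto
      then have "step (hd v) (last u) = - s" using uv(6) by (auto simp: step_def split: if_splits)
      moreover have "ends_min (rev v)" "starts_min (rev u)"
        using starts_min_rev[of "rev v"] starts_min_rev[of u] uv d by auto
      ultimately show ?thesis using uv by (auto simp: min_cuts_def last_rev hd_rev)
    qed
    show "(\<lambda>(u, v). (rev v, rev u)) \<in> min_cuts (-1) w \<rightarrow> min_cuts 1 (rev w)"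
      using *[of _ _ "-1" w] assms by auto
    show "(\<lambda>(u, v). (rev v, rev u)) \<in> min_cuts 1 (rev w) \<rightarrow> min_cuts (-1) w"
      using *[of _ _ 1 "rev w"] assms by auto
  qed auto
  then have "card (min_cuts (-1) w) = card (min_cuts 1 (rev w))" by (rule bij_betw_same_card)
  also have "\<dots> = (if starts_min w then 0 else 1)"
    using card_min_cuts_up[of "rev w"] starts_min_rev[of "rev w"] assms by simp
  finally show ?thesis .
qed

section \<open>Factorization of the word sum by ballot words\<close>

context marked_peaks begin

text \<open>A marked last letter of \<open>u\<close> would lie one step above its predecessor,
  against \<open>ends_min u\<close>; symmetrically for the first letter of \<open>v\<close>. So
  cutting at minima never breaks a marked peak.\<close>

lemma min_cuts_subset_cuts:
  assumes "good w"
  shows "min_cuts s w \<subseteq> cuts w"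
proof clarify
  fix u v assume "(u, v) \<in> min_cuts s w"
  then have uv: "u @ v = w" "u \<noteq> []" "v \<noteq> []" "ends_min u" "starts_min v"
    by (auto simp: min_cuts_def)
  have "last u \<notin> K"
  proof
    assume k: "last u \<in> K"
    have "butlast u @ last u # v = w"
      using uv(1) append_butlast_last_id[OF uv(2)] by (metis append_Cons append_Nil append_assoc)
    with assms have g: "good (butlast u @ last u # v)" by metis
    then obtain u' b where b: "butlast u = u' @ [b]"
      using goodD(1)[OF g k] by (cases "butlast u" rule: rev_cases) auto
    then have "b < last u" using goodD(3)[OF g k] by simp
    moreover have "u = u' @ [b, last u]" using b uv(2) append_butlast_last_id[of u] by simp
    then have "ht [b, last u] \<le> 0" using uv(4) unfolding ends_min_def by blast
    ultimately show False by (simp add: step_def)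
  qed
  moreover have "hd v \<notin> K"
  proof
    assume k: "hd v \<in> K"
    have "u @ hd v # tl v = w" using uv by simp
    with assms have g: "good (u @ hd v # tl v)" by metis
    then obtain b v' where b: "tl v = b # v'"
      using goodD(2)[OF g k] by (cases "tl v") auto
    then have "b < hd v" using goodD(4)[OF g k] by simp
    moreover have "v = [hd v, b] @ v'" using b uv(3) by (cases v) auto
    then have "0 \<le> ht [hd v, b]" using uv(5) unfolding starts_min_def by blast
    ultimately show False by (simp add: step_def)
  qed
  ultimately show "(u, v) \<in> cuts w" using uv by (auto simp: cuts_def)
qed

text \<open>Expand \<open>weight_sum q\<close>. The term \<open>q powi (ht w - 1)\<close> belongs to
  the unique ascent cut or, when there is none, to \<open>ends_min w\<close>; the term
  \<open>q powi (ht w + 1)\<close> belongs to the descent cut or to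
  \<open>starts_min w\<close>.\<close>

lemma weighted_min_cuts:
  assumes "q \<noteq> 0" "good w" "distinct w" "w \<noteq> []"
  shows "weight_sum q * q powi ht w =
    (if starts_min w then q powi (ht w + 1) else 0) + (if ends_min w then q powi (ht w - 1) else 0) +
    (\<Sum>(u, v)\<in>cuts w. if ends_min u \<and> starts_min v then q powi (ht u - 1) * q powi (ht v + 1) else 0)"
proof -
  let ?f = "\<lambda>(u, v). q powi (ht u - 1) * q powi (ht v + 1)"
  have fin: "finite (min_cuts s w)" for s
    using min_cuts_subset_cuts[OF assms(2)] by (rule finite_subset) simp
  have s: "sum ?f (min_cuts s w) = card (min_cuts s w) * q powi (ht w - s)" for s
  proof -
    have "?f z = q powi (ht w - s)" if "z \<in> min_cuts s w" for z
    proof -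
      obtain u v where z: "z = (u, v)" by force
      have "ht w = ht u + s + ht v" using that z ht_append[of u v] by (auto simp: min_cuts_def)
      then have "ht w - s = (ht u - 1) + (ht v + 1)" by simp
      then show ?thesis unfolding z using assms(1) power_int_add[of q "ht u - 1" "ht v + 1"] by simp
    qed
    then show ?thesis by simp
  qed
  have "(\<Sum>(u, v)\<in>cuts w. if ends_min u \<and> starts_min v then ?f (u, v) else 0) =
      sum ?f (min_cuts 1 w \<union> min_cuts (-1) w)"
  proof (rule sum.mono_neutral_cong_right)
    show "min_cuts 1 w \<union> min_cuts (-1) w \<subseteq> cuts w" using min_cuts_subset_cuts[OF assms(2)] by blast
    show "finite (cuts w)" by simp
  qed (auto simp: min_cuts_def cuts_def step_def split: if_splits)
  also have "\<dots> = sum ?f (min_cuts 1 w) + sum ?f (min_cuts (-1) w)"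
    using fin by (intro sum.union_disjoint) (auto simp: min_cuts_def)
  also have "\<dots> = (if ends_min w then 0 else q powi (ht w - 1)) +
      (if starts_min w then 0 else q powi (ht w + 1))"
    unfolding s using card_min_cuts_up[OF assms(4)] card_min_cuts_down[OF assms(4,3)] by simp
  finally have "(if starts_min w then q powi (ht w + 1) else 0) +
      (if ends_min w then q powi (ht w - 1) else 0) +
      (\<Sum>(u, v)\<in>cuts w. if ends_min u \<and> starts_min v then ?f (u, v) else 0) =
      q powi (ht w + 1) + q powi (ht w - 1)" by simp
  also have "\<dots> = weight_sum q * q powi ht w"
    using assms(1) by (simp add: weight_sum_def power_int_add power_int_diff field_simps)
  finally show ?thesis unfolding prod.case by (rule sym)
qed

definition ballots :: "nat set \<Rightarrow> nat list set" where
  "ballots S = {w \<in> words S. starts_min w}"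

text \<open>The shift by 1 makes all exponents on nonempty sets positive and fits the split of a cut
  into \<open>ht u - 1\<close> and \<open>ht v + 1\<close>.\<close>

definition ballot_sum :: "real \<Rightarrow> nat set \<Rightarrow> real" where
  "ballot_sum q S = (if S = {} then 1 else \<Sum>w\<in>ballots S. q powi (ht w + 1))"

text \<open>Reversal turns words ending at a minimum into ballot words and \<open>ht w - 1\<close>
  into the negative of \<open>ht (rev w) + 1\<close>.\<close>

lemma sum_ends_min:
  fixes q :: real
  shows "(\<Sum>w\<in>words S. if ends_min w then q powi (ht w - 1) else 0) =
    (\<Sum>w\<in>ballots S. inverse q powi (ht w + 1))"
proof -
  have "(\<Sum>w\<in>words S. if ends_min w then q powi (ht w - 1) else 0) =
      (\<Sum>w\<in>words S. if starts_min (rev w) then inverse q powi (ht (rev w) + 1) else 0)"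
  proof (rule sum.cong[OF refl])
    fix w assume "w \<in> words S"
    then have d: "distinct w" by (simp add: words_def)
    have "q powi (ht w - 1) = inverse q powi (- ht w + 1)"
      using power_int_minus[of q "- ht w + 1"] by (simp add: power_int_inverse)
    then show "(if ends_min w then q powi (ht w - 1) else 0) =
        (if starts_min (rev w) then inverse q powi (ht (rev w) + 1) else 0)"
      using d by (simp add: starts_min_rev ht_rev)
  qed
  also have "\<dots> = (\<Sum>w\<in>words S. if starts_min w then inverse q powi (ht w + 1) else 0)"
    by (rule sum_words_rev)
  also have "\<dots> = (\<Sum>w\<in>ballots S. inverse q powi (ht w + 1))"
    unfolding ballots_def by (rule sum.inter_filter[symmetric]) simp
  finally show ?thesis .
qed

text \<open>A word with an admissible cut amounts to a pair of good words on complementary nonempty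
  sets: good words have unmarked ends, so their concatenation is always cut admissibly.\<close>

lemma sum_cuts:
  assumes "finite S"
  shows "(\<Sum>w\<in>words S. \<Sum>(u, v)\<in>cuts w. f u v) =
    (\<Sum>T\<in>Pow S - {{}, S}. \<Sum>u\<in>words T. \<Sum>v\<in>words (S - T). f u v)"
proof -
  have "(\<Sum>w\<in>words S. \<Sum>(u, v)\<in>cuts w. f u v) =
      (\<Sum>(w, u, v)\<in>Sigma (words S) cuts. f u v)"
    by (subst sum.Sigma) (auto simp: case_prod_unfold)
  also have "\<dots> = (\<Sum>(T, u, v)\<in>Sigma (Pow S - {{}, S}) (\<lambda>T. words T \<times> words (S - T)). f u v)"
  proof (rule sum.reindex_bij_witness
      [of _ "\<lambda>(T, u, v). (u @ v, u, v)" "\<lambda>(w, u, v). (set u, u, v)"])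
    fix z assume z: "z \<in> Sigma (words S) cuts"
    obtain w u v where e: "z = (w, u, v)" by (metis prod.exhaust)
    have w: "distinct w" "set w = S" "good w"
      and uv: "u @ v = w" "u \<noteq> []" "v \<noteq> []" "last u \<notin> K" "hd v \<notin> K"
      using z by (auto simp: e words_def cuts_def)
    have "good u" "good v" using good_append_iff[of u v] w uv by auto
    moreover have "set u \<union> set v = S" "set u \<inter> set v = {}" "distinct u" "distinct v"
      using w uv by auto
    moreover have "set u \<noteq> {}" "hd v \<in> set v" using uv by auto
    ultimately show "(\<lambda>(w, u, v). (set u, u, v)) z \<in> Sigma (Pow S - {{}, S}) (\<lambda>T. words T \<times> words (S - T))"
      by (auto simp: e words_def)
    show "(\<lambda>(T, u, v). (u @ v, u, v)) ((\<lambda>(w, u, v). (set u, u, v)) z) = z"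
      using uv by (simp add: e)
  next
    fix z assume z: "z \<in> Sigma (Pow S - {{}, S}) (\<lambda>T. words T \<times> words (S - T))"
    obtain T u v where e: "z = (T, u, v)" by (metis prod.exhaust)
    have T: "T \<subseteq> S" "T \<noteq> {}" "T \<noteq> S"
      and u: "distinct u" "set u = T" "good u" and v: "distinct v" "set v = S - T" "good v"
      using z by (auto simp: e words_def)
    have ne: "u \<noteq> []" "v \<noteq> []" using T u v by auto
    have "good (u @ v) \<and> last u \<notin> K \<and> hd v \<notin> K" using good_append_iff[OF ne] u v by auto
    then show "(\<lambda>(T, u, v). (u @ v, u, v)) z \<in> Sigma (words S) cuts"
      using T u v ne by (auto simp: e words_def cuts_def)
    show "(\<lambda>(w, u, v). (set u, u, v)) ((\<lambda>(T, u, v). (u @ v, u, v)) z) = z"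
      using u by (simp add: e)
  qed auto
  also have "\<dots> = (\<Sum>T\<in>Pow S - {{}, S}. \<Sum>(u, v)\<in>words T \<times> words (S - T). f u v)"
    using assms by (subst sum.Sigma) auto
  finally show ?thesis by (simp add: sum.cartesian_product)
qed

text \<open>Sum \<open>weighted_min_cuts\<close> over all words: \<open>starts_min\<close> words
  give \<open>T = {}\<close>, \<open>ends_min\<close> words give \<open>T = S\<close>, and cuts give
  all other \<open>T\<close>.\<close>

lemma word_sum_ballot:
  assumes "q \<noteq> 0" "finite S"
  shows "word_sum q S = (\<Sum>T\<in>Pow S. ballot_sum (inverse q) T * ballot_sum q (S - T))"
proof (cases "S = {}")
  case True
  then show ?thesis by (simp add: word_sum_def ballot_sum_def)
next
  case False
  let ?F = "\<lambda>u v. if ends_min u \<and> starts_min v then q powi (ht u - 1) * q powi (ht v + 1) else 0"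
  have "word_sum q S = (\<Sum>w\<in>words S. (if starts_min w then q powi (ht w + 1) else 0) +
      (if ends_min w then q powi (ht w - 1) else 0) + (\<Sum>(u, v)\<in>cuts w. ?F u v))"
  proof -
    have "weight_sum q * q powi ht w = (if starts_min w then q powi (ht w + 1) else 0) +
      (if ends_min w then q powi (ht w - 1) else 0) + (\<Sum>(u, v)\<in>cuts w. ?F u v)"
      if "w \<in> words S" for w
      by (rule weighted_min_cuts) (use assms False that in \<open>auto simp: words_def\<close>)
    then show ?thesis using False by (simp add: word_sum_def sum_distrib_left)
  qed
  also have "\<dots> = (\<Sum>w\<in>words S. if starts_min w then q powi (ht w + 1) else 0) +
      (\<Sum>w\<in>words S. if ends_min w then q powi (ht w - 1) else 0) +
      (\<Sum>w\<in>words S. \<Sum>(u, v)\<in>cuts w. ?F u v)" by (simp add: sum.distrib)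
  also have "(\<Sum>w\<in>words S. if starts_min w then q powi (ht w + 1) else 0) = ballot_sum q S"
    using False by (simp add: ballot_sum_def ballots_def sum.inter_filter)
  also have "(\<Sum>w\<in>words S. if ends_min w then q powi (ht w - 1) else 0) = ballot_sum (inverse q) S"
    using False by (simp add: ballot_sum_def sum_ends_min)
  also have "(\<Sum>w\<in>words S. \<Sum>(u, v)\<in>cuts w. ?F u v) =
      (\<Sum>T\<in>Pow S - {{}, S}. \<Sum>u\<in>words T. \<Sum>v\<in>words (S - T). ?F u v)"
    by (rule sum_cuts[OF assms(2)])
  also have "\<dots> = (\<Sum>T\<in>Pow S - {{}, S}. ballot_sum (inverse q) T * ballot_sum q (S - T))"
  proof (rule sum.cong[OF refl])
    fix T assume T: "T \<in> Pow S - {{}, S}"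
    have "(\<Sum>u\<in>words T. \<Sum>v\<in>words (S - T). ?F u v) =
        (\<Sum>u\<in>words T. \<Sum>v\<in>words (S - T). (if ends_min u then q powi (ht u - 1) else 0) *
          (if starts_min v then q powi (ht v + 1) else 0))"
      by (intro sum.cong) auto
    also have "\<dots> = (\<Sum>u\<in>words T. if ends_min u then q powi (ht u - 1) else 0) *
        (\<Sum>v\<in>words (S - T). if starts_min v then q powi (ht v + 1) else 0)"
      by (simp add: sum_product)
    also have "\<dots> = ballot_sum (inverse q) T * ballot_sum q (S - T)"
      using T unfolding sum_ends_min by (auto simp: ballot_sum_def ballots_def sum.inter_filter)
    finally show "(\<Sum>u\<in>words T. \<Sum>v\<in>words (S - T). ?F u v) =
        ballot_sum (inverse q) T * ballot_sum q (S - T)" .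
  qed
  also have "ballot_sum q S + ballot_sum (inverse q) S + \<dots> =
      (\<Sum>T\<in>Pow S. ballot_sum (inverse q) T * ballot_sum q (S - T))"
  proof -
    have "Pow S = insert {} (insert S (Pow S - {{}, S}))" by auto
    then have "(\<Sum>T\<in>Pow S. ballot_sum (inverse q) T * ballot_sum q (S - T)) =
        (\<Sum>T\<in>insert {} (insert S (Pow S - {{}, S})). ballot_sum (inverse q) T * ballot_sum q (S - T))"
      by simp
    also have "\<dots> = ballot_sum q S + (ballot_sum (inverse q) S +
        (\<Sum>T\<in>Pow S - {{}, S}. ballot_sum (inverse q) T * ballot_sum q (S - T)))"
      using False assms(2) by (subst sum.insert; simp) (simp add: ballot_sum_def)
    finally show ?thesis by simp
  qed
  finally show ?thesis .
qed

end

section \<open>Extracting a cycle from a permutation\<close>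

lemma self_in_cycle_of: "x \<in> cycle_of \<sigma> x"
  unfolding cycle_of_def by (metis (mono_tags, lifting) funpow_0 mem_Collect_eq)

lemma cycle_of_range: "cycle_of \<sigma> x = range (\<lambda>k. (\<sigma> ^^ k) x)"
  by (auto simp: cycle_of_def)

text \<open>Some power \<open>n > i\<close> of the permutation is the identity, so
  \<open>n - i\<close> further steps lead from \<open>y\<close> back to \<open>x\<close>.\<close>

lemma cycle_of_eq:
  assumes "permutation \<sigma>" "y \<in> cycle_of \<sigma> x"
  shows "cycle_of \<sigma> y = cycle_of \<sigma> x"
proof -
  obtain i where i: "y = (\<sigma> ^^ i) x" using assms(2) by (auto simp: cycle_of_def)
  obtain n where n: "\<sigma> ^^ n = id" "n > i" using permutation_is_nilpotent'[OF assms(1)] by blast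
  have x: "x = (\<sigma> ^^ (n - i)) y"
    unfolding i using n funpow_add[of "n - i" i \<sigma>] by (metis add_diff_inverse_nat add.commute
      comp_apply id_apply less_imp_not_less)
  have "(\<sigma> ^^ k) y = (\<sigma> ^^ (k + i)) x" for k by (simp add: i funpow_add)
  moreover have "(\<sigma> ^^ k) x = (\<sigma> ^^ (k + (n - i))) y" for k
    by (subst x) (simp add: funpow_add)
  ultimately show ?thesis unfolding cycle_of_def by blast
qed

text \<open>Also applied with \<open>\<sigma> = \<tau>\<close>, to keep a cycle inside an invariant
  set.\<close>

lemma cycle_of_cong:
  assumes "x \<in> A" "\<And>y. y \<in> A \<Longrightarrow> \<sigma> y = \<tau> y" "\<And>y. y \<in> A \<Longrightarrow> \<tau> y \<in> A"
  shows "cycle_of \<sigma> x = cycle_of \<tau> x" "cycle_of \<tau> x \<subseteq> A"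
proof -
  have "(\<sigma> ^^ k) x = (\<tau> ^^ k) x \<and> (\<tau> ^^ k) x \<in> A" for k
    by (induction k) (use assms in auto)
  then show "cycle_of \<sigma> x = cycle_of \<tau> x" "cycle_of \<tau> x \<subseteq> A" by (auto simp: cycle_of_def)
qed

text \<open>The equation \<open>map \<sigma> (a # r) = r @ [a]\<close> is the working form of
  "\<open>(a r)\<close> is a cycle of \<open>\<sigma>\<close>": each letter goes to the next one,
  and the last returns to \<open>a\<close>.\<close>

lemma follows_funpow:
  assumes "map \<sigma> (a # r) = r @ [a]" "i < length (a # r)"
  shows "(\<sigma> ^^ i) a = (a # r) ! i"
  using assms(2)
proof (induction i)
  case (Suc i)
  then have "(\<sigma> ^^ Suc i) a = map \<sigma> (a # r) ! i" by (simp del: list.map)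
  also have "\<dots> = (a # r) ! Suc i" unfolding assms(1) using Suc.prems by (simp add: nth_append)
  finally show ?case .
qed simp

text \<open>The orbit of \<open>a\<close> closes after \<open>length (a # r)\<close> steps and, by
  distinctness, not earlier. Hence the word of a cycle is determined by its starting letter;
  \<open>support_follows\<close> gives its existence.\<close>

lemma follows_support:
  assumes "map \<sigma> (a # r) = r @ [a]" "distinct (a # r)" "permutation \<sigma>"
  shows "support \<sigma> a = a # r" "cycle_of \<sigma> a = set (a # r)"
proof -
  let ?m = "length (a # r)"
  have "(\<sigma> ^^ ?m) a = map \<sigma> (a # r) ! length r"
    using follows_funpow[OF assms(1), of "length r"] by (simp del: list.map)
  also have "\<dots> = a" unfolding assms(1) by simp
  finally have m: "(\<sigma> ^^ ?m) a = a" .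
  have "least_power \<sigma> a = ?m"
    unfolding least_power_def
  proof (rule Least_equality)
    show "(\<sigma> ^^ ?m) a = a \<and> 0 < ?m" using m by simp
    fix i assume i: "(\<sigma> ^^ i) a = a \<and> 0 < i"
    show "?m \<le> i"
    proof (rule ccontr)
      assume "\<not> ?m \<le> i"
      then have "(a # r) ! i = (a # r) ! 0" using follows_funpow[OF assms(1), of i] i by simp
      then show False using nth_eq_iff_index_eq[OF assms(2), of i 0] i \<open>\<not> ?m \<le> i\<close> by simp
    qed
  qed
  then show s: "support \<sigma> a = a # r"
    using follows_funpow[OF assms(1)] by (intro nth_equalityI) (auto simp del: upt_Suc)
  show "cycle_of \<sigma> a = set (a # r)"
    using support_set[OF assms(3), of a] unfolding s cycle_of_range by simp
qed

lemma support_follows: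
  assumes "permutation \<sigma>"
  shows "support \<sigma> a = a # tl (support \<sigma> a)"
    "map \<sigma> (a # tl (support \<sigma> a)) = tl (support \<sigma> a) @ [a]"
    "distinct (a # tl (support \<sigma> a))" "set (a # tl (support \<sigma> a)) = cycle_of \<sigma> a"
proof -
  let ?l = "least_power \<sigma> a"
  have l: "(\<sigma> ^^ ?l) a = a" "?l > 0" using least_power_of_permutation[OF assms] by auto
  then show s: "support \<sigma> a = a # tl (support \<sigma> a)"
    by (simp add: upt_conv_Cons)
  show "distinct (a # tl (support \<sigma> a))" unfolding s[symmetric] by (rule cycle_of_permutation[OF assms])
  show "set (a # tl (support \<sigma> a)) = cycle_of \<sigma> a"
    unfolding s[symmetric] cycle_of_range by (rule support_set[OF assms])
  show "map \<sigma> (a # tl (support \<sigma> a)) = tl (support \<sigma> a) @ [a]"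
    unfolding s[symmetric]
  proof (rule nth_equalityI)
    fix i assume i: "i < length (map \<sigma> (support \<sigma> a))"
    show "map \<sigma> (support \<sigma> a) ! i = (tl (support \<sigma> a) @ [a]) ! i"
    proof (cases "Suc i < ?l")
      case True
      then have "i < ?l - 1" by linarith
      then show ?thesis using True by (simp add: nth_append nth_tl)
    next
      case False
      then have "Suc i = ?l" using i by simp
      then have "\<sigma> ((\<sigma> ^^ i) a) = a" using l(1) by (metis comp_apply funpow.simps(2))
      moreover have "\<not> i < ?l - 1" using \<open>Suc i = ?l\<close> by linarith
      ultimately show ?thesis using \<open>Suc i = ?l\<close> by (simp add: nth_append)
    qed
  qed (use l in simp)
qed

text \<open>This is \<open>casc - cdes\<close> as an integer.\<close>

definition turn :: "(nat \<Rightarrow> nat) \<Rightarrow> nat set \<Rightarrow> int" where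
  "turn \<sigma> C = 2 * int (casc \<sigma> C) - int (card C)"

text \<open>The end letter \<open>y\<close> is kept apart from \<open>x\<close> so that the
  induction can drop the first letter.\<close>

lemma ht_follows:
  "map \<sigma> (x # r) = r @ [y] \<Longrightarrow> ht (x # r @ [y]) = (\<Sum>z\<leftarrow>x # r. step z (\<sigma> z))"
  by (induction r arbitrary: x) auto

lemma turn_conv_sum:
  assumes "finite C"
  shows "turn \<sigma> C = (\<Sum>z\<in>C. step z (\<sigma> z))"
proof -
  have "(\<Sum>z\<in>C. step z (\<sigma> z)) = (\<Sum>z\<in>C. 2 * (if z < \<sigma> z then 1 else 0) - 1)"
    by (rule sum.cong) (auto simp: step_def)
  also have "\<dots> = 2 * int (card {z \<in> C. z < \<sigma> z}) - int (card C)"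
    using assms by (simp add: sum_subtractf sum_distrib_left[symmetric] sum.If_cases Int_def)
  finally show ?thesis by (simp add: turn_def casc_def)
qed

lemma turn_follows:
  assumes "map \<sigma> (a # r) = r @ [a]" "distinct (a # r)"
  shows "turn \<sigma> (set (a # r)) = ht (a # r @ [a])"
  unfolding ht_follows[OF assms(1)] turn_conv_sum[OF finite_set]
  by (rule sum_list_distinct_conv_sum_set[OF assms(2), symmetric])

definition total_turn :: "(nat \<Rightarrow> nat) \<Rightarrow> nat set \<Rightarrow> int" where
  "total_turn \<sigma> S = (\<Sum>C\<in>cycle_of \<sigma> ` S. \<bar>turn \<sigma> C\<bar>)"

lemma follows_next:
  assumes "map \<sigma> (a # r) = r @ [a]" "a # r @ [a] = xs @ x # y # ys"
  shows "\<sigma> x = y"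
proof -
  have l: "length xs < length (a # r)" using arg_cong[OF assms(2), of length] by simp
  have "x = (a # r @ [a]) ! length xs" "y = (a # r @ [a]) ! Suc (length xs)"
    unfolding assms(2) by (auto simp: nth_append)
  moreover have "(a # r @ [a]) ! length xs = (a # r) ! length xs"
    using l nth_append[of "a # r" "[a]"] by simp
  moreover have "\<sigma> ((a # r) ! length xs) = map \<sigma> (a # r) ! length xs" using l by (simp del: list.map)
  ultimately show ?thesis unfolding assms(1) by simp
qed

text \<open>The final copy of \<open>a\<close> supplies the cyclic successor of the last letter, so
  word neighbors inside \<open>a r a\<close> are cyclic neighbors.\<close>

lemma follows_neighbors:
  assumes "map \<sigma> (a # r) = r @ [a]" "bij \<sigma>" "a # r @ [a] = xs @ b # ys" "xs \<noteq> []" "ys \<noteq> []"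
  shows "inv \<sigma> b = last xs" "\<sigma> b = hd ys"
proof -
  have "\<sigma> (last xs) = b"
    by (rule follows_next[OF assms(1), of "butlast xs" _ _ ys])
      (use assms(3,4) append_butlast_last_id[of xs] in \<open>metis append_Cons append_Nil append_assoc\<close>)
  then show "inv \<sigma> b = last xs" using assms(2) by (metis bij_inv_eq_iff)
  show "\<sigma> b = hd ys"
    by (rule follows_next[OF assms(1), of xs _ _ "tl ys"]) (use assms(3,5) in simp)
qed

section \<open>Removing the cycle through an unmarked letter\<close>

context marked_peaks begin

definition peaks_ok :: "(nat \<Rightarrow> nat) \<Rightarrow> nat set \<Rightarrow> bool" where
  "peaks_ok \<sigma> S \<longleftrightarrow> (\<forall>b\<in>K \<inter> S. inv \<sigma> b < b \<and> \<sigma> b < b \<and> N b = {inv \<sigma> b, \<sigma> b})"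

lemma peaks_ok_follows:
  assumes "map \<sigma> (a # r) = r @ [a]" "distinct (a # r)" "bij \<sigma>" "a \<notin> K"
  shows "peaks_ok \<sigma> (set (a # r)) \<longleftrightarrow> good (a # r @ [a])"
proof
  assume g: "good (a # r @ [a])"
  show "peaks_ok \<sigma> (set (a # r))" unfolding peaks_ok_def
  proof
    fix b assume b: "b \<in> K \<inter> set (a # r)"
    then have "b \<in> set r" using assms(4) by auto
    then obtain r1 r2 where r: "r = r1 @ b # r2" by (meson split_list)
    have e: "a # r @ [a] = (a # r1) @ b # r2 @ [a]" by (simp add: r)
    show "inv \<sigma> b < b \<and> \<sigma> b < b \<and> N b = {inv \<sigma> b, \<sigma> b}"
      using follows_neighbors[OF assms(1,3) e] goodD[OF g[unfolded e]] b by auto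
  qed
next
  assume p: "peaks_ok \<sigma> (set (a # r))"
  show "good (a # r @ [a])" unfolding good_def
  proof (intro allI impI)
    fix xs b ys assume e: "a # r @ [a] = xs @ b # ys" and b: "b \<in> K"
    have ba: "b \<noteq> a" using b assms(4) by auto
    have x: "xs \<noteq> []" using e ba by (cases xs) auto
    have y: "ys \<noteq> []"
    proof
      assume "ys = []"
      then have "last (a # r @ [a]) = b" unfolding e by simp
      then show False using ba by simp
    qed
    have "b \<in> set (a # r @ [a])" unfolding e by simp
    then have "b \<in> K \<inter> set (a # r)" using b by auto
    then show "xs \<noteq> [] \<and> ys \<noteq> [] \<and> last xs < b \<and> hd ys < b \<and> N b = {last xs, hd ys}"
      using p x y follows_neighbors[OF assms(1,3) e x y] unfolding peaks_ok_def by metis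
  qed
qed

definition cperms :: "nat set \<Rightarrow> (nat \<Rightarrow> nat) set" where
  "cperms S = {\<sigma>. \<sigma> permutes S \<and> (\<forall>x\<in>S. odd (card (cycle_of \<sigma> x))) \<and> peaks_ok \<sigma> S}"

lemma finite_cperms: "finite S \<Longrightarrow> finite (cperms S)"
  by (rule finite_subset[OF _ finite_permutations[of S]]) (auto simp: cperms_def)

text \<open>Here \<open>\<sigma>\<close> is the cycle \<open>(a r)\<close> on \<open>T\<close> and
  agrees with \<open>\<tau>\<close> on \<open>S - T\<close>. Turn, parity and peak conditions all
  decompose over these two invariant sets.\<close>

lemma split_cycle:
  assumes "finite S" "a \<in> S" "a \<notin> K" "\<sigma> permutes S" "map \<sigma> (a # r) = r @ [a]" "distinct (a # r)"
    "set (a # r) = T" "T \<subseteq> S" "\<tau> permutes S - T" "\<And>x. x \<in> S - T \<Longrightarrow> \<sigma> x = \<tau> x"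
  shows "total_turn \<sigma> S = \<bar>ht (a # r @ [a])\<bar> + total_turn \<tau> (S - T)"
    and "\<sigma> \<in> cperms S \<longleftrightarrow> odd (card T) \<and> good (a # r @ [a]) \<and> \<tau> \<in> cperms (S - T)"
proof -
  have perm: "permutation \<sigma>" using assms(1,4) by (auto simp: permutation_permutes)
  have aT: "a \<in> T" "finite T" using assms(7) by auto
  have "cycle_of \<sigma> a = T" using follows_support(2)[OF assms(5,6) perm] assms(7) by simp
  then have T: "cycle_of \<sigma> x = T" if "x \<in> T" for x
    using cycle_of_eq[OF perm, of x a] that by simp
  have R: "cycle_of \<sigma> x = cycle_of \<tau> x" "cycle_of \<tau> x \<subseteq> S - T" if "x \<in> S - T" for x
    using cycle_of_cong[of x "S - T" \<sigma> \<tau>] that assms(9,10) permutes_in_image[OF assms(9)] by auto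
  have im: "cycle_of \<sigma> ` S = insert T (cycle_of \<tau> ` (S - T))"
  proof -
    have "cycle_of \<sigma> ` S = cycle_of \<sigma> ` T \<union> cycle_of \<sigma> ` (S - T)" using assms(8) by auto
    also have "cycle_of \<sigma> ` T = {T}" using T aT by auto
    also have "cycle_of \<sigma> ` (S - T) = cycle_of \<tau> ` (S - T)" using R by auto
    finally show ?thesis by simp
  qed
  have "T \<notin> cycle_of \<tau> ` (S - T)" using R(2) aT by auto
  then have "total_turn \<sigma> S = \<bar>turn \<sigma> T\<bar> + (\<Sum>C\<in>cycle_of \<tau> ` (S - T). \<bar>turn \<sigma> C\<bar>)"
    unfolding total_turn_def im using assms(1) by (subst sum.insert) auto
  also have "turn \<sigma> T = ht (a # r @ [a])" using turn_follows[OF assms(5,6)] assms(7) by simp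
  also have "(\<Sum>C\<in>cycle_of \<tau> ` (S - T). \<bar>turn \<sigma> C\<bar>) = total_turn \<tau> (S - T)"
    unfolding total_turn_def
  proof (rule sum.cong[OF refl])
    fix C assume "C \<in> cycle_of \<tau> ` (S - T)"
    then have C: "C \<subseteq> S - T" using R(2) by auto
    then have "{c \<in> C. c < \<sigma> c} = {c \<in> C. c < \<tau> c}" using assms(10) by auto
    then show "\<bar>turn \<sigma> C\<bar> = \<bar>turn \<tau> C\<bar>" by (simp add: turn_def casc_def)
  qed
  finally show "total_turn \<sigma> S = \<bar>ht (a # r @ [a])\<bar> + total_turn \<tau> (S - T)" .
  have "peaks_ok \<sigma> S \<longleftrightarrow> peaks_ok \<sigma> T \<and> peaks_ok \<sigma> (S - T)"
    using assms(8) unfolding peaks_ok_def by blast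
  also have "peaks_ok \<sigma> T \<longleftrightarrow> good (a # r @ [a])"
    using peaks_ok_follows[OF assms(5,6) permutes_bij[OF assms(4)] assms(3)] assms(7) by simp
  also have "peaks_ok \<sigma> (S - T) \<longleftrightarrow> peaks_ok \<tau> (S - T)"
  proof -
    have "inv \<sigma> b = inv \<tau> b" if b: "b \<in> S - T" for b
    proof -
      have i: "inv \<tau> b \<in> S - T" using b permutes_in_image[OF permutes_inv[OF assms(9)]] by blast
      then have "\<sigma> (inv \<tau> b) = b" using assms(10) permutes_inverses(1)[OF assms(9)] by simp
      then show ?thesis using permutes_inv_eq[OF assms(4)] by blast
    qed
    then show ?thesis using assms(10) by (auto simp: peaks_ok_def)
  qed
  finally have p: "peaks_ok \<sigma> S \<longleftrightarrow> good (a # r @ [a]) \<and> peaks_ok \<tau> (S - T)" .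
  have "(\<forall>x\<in>S. odd (card (cycle_of \<sigma> x))) \<longleftrightarrow>
      odd (card T) \<and> (\<forall>x\<in>S - T. odd (card (cycle_of \<tau> x)))"
  proof
    assume o: "\<forall>x\<in>S. odd (card (cycle_of \<sigma> x))"
    have "odd (card T)" using o[rule_format, OF assms(2)] T[OF aT(1)] by simp
    moreover have "odd (card (cycle_of \<tau> x))" if "x \<in> S - T" for x
      using o[rule_format, of x] R(1)[OF that] that by simp
    ultimately show "odd (card T) \<and> (\<forall>x\<in>S - T. odd (card (cycle_of \<tau> x)))" by blast
  next
    assume o: "odd (card T) \<and> (\<forall>x\<in>S - T. odd (card (cycle_of \<tau> x)))"
    have "odd (card (cycle_of \<sigma> x))" if "x \<in> S" for x
      using o T[of x] R(1)[of x] that by (cases "x \<in> T") auto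
    then show "\<forall>x\<in>S. odd (card (cycle_of \<sigma> x))" by blast
  qed
  then show "\<sigma> \<in> cperms S \<longleftrightarrow> odd (card T) \<and> good (a # r @ [a]) \<and> \<tau> \<in> cperms (S - T)"
    using p assms(4,9) unfolding cperms_def by blast
qed

definition cperm_sum :: "real \<Rightarrow> nat set \<Rightarrow> real" where
  "cperm_sum q S = (\<Sum>\<sigma>\<in>cperms S. q powi total_turn \<sigma> S)"

text \<open>Removing the cycle through \<open>a\<close> is a bijection onto triples: the letters
  \<open>T\<close> of the cycle, its word \<open>r\<close> after \<open>a\<close>, and the remaining
  permutation \<open>\<tau>\<close>.\<close>

lemma cperm_sum_rec:
  assumes "q \<noteq> 0" "finite S" "a \<in> S" "a \<notin> K"
  shows "cperm_sum q S = (\<Sum>T | T \<subseteq> S \<and> a \<in> T \<and> odd (card T).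
    (\<Sum>r\<in>rings a T. q powi \<bar>ht (a # r @ [a])\<bar>) * cperm_sum q (S - T))"
proof -
  let ?T = "{T. T \<subseteq> S \<and> a \<in> T \<and> odd (card T)}"
  let ?I = "Sigma ?T (\<lambda>T. rings a T \<times> cperms (S - T))"
  let ?f = "\<lambda>(T, r, \<tau>). q powi \<bar>ht (a # r @ [a])\<bar> * q powi total_turn \<tau> (S - T)"
  have fT: "finite ?T" using assms(2) by simp
  have "cperm_sum q S = sum ?f ?I"
    unfolding cperm_sum_def
  \<comment> \<open>Composition with \<open>cycle_of_list (a # r)\<close> glues the cycle back. In
    the other direction \<open>\<sigma>\<close> is replaced by the identity on its cycle through
    \<open>a\<close>, so that the rest permutes \<open>S - T\<close>.\<close>
  proof (rule sum.reindex_bij_witness[of _ "\<lambda>(T, r, \<tau>). cycle_of_list (a # r) \<circ> \<tau>"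
        "\<lambda>\<sigma>. (cycle_of \<sigma> a, tl (support \<sigma> a), \<lambda>y. if y \<in> S - cycle_of \<sigma> a then \<sigma> y else y)"])
    fix \<sigma> assume s: "\<sigma> \<in> cperms S"
    define r where "r = tl (support \<sigma> a)"
    define T where "T = cycle_of \<sigma> a"
    define \<tau> where "\<tau> = (\<lambda>y. if y \<in> S - T then \<sigma> y else y)"
    have p: "\<sigma> permutes S" using s by (simp add: cperms_def)
    then have perm: "permutation \<sigma>" using assms(2) by (auto simp: permutation_permutes)
    note sf = support_follows[OF perm, of a, folded r_def T_def]
    have TS: "T \<subseteq> S" using cycle_of_cong(2)[of a S \<sigma> \<sigma>] assms(3) permutes_in_image[OF p]
      unfolding T_def by auto
    have "set (support \<sigma> a) = T" unfolding T_def cycle_of_range by (rule support_set[OF perm])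
    with semidecomposition[OF p assms(2), of a] have t: "\<tau> permutes S - T"
      unfolding \<tau>_def by metis
    have st: "\<sigma> x = \<tau> x" if "x \<in> S - T" for x using that by (simp add: \<tau>_def)
    note sc = split_cycle[OF assms(2-4) p sf(2,3,4) TS t st]
    show "(\<lambda>(T, r, \<tau>). cycle_of_list (a # r) \<circ> \<tau>) (cycle_of \<sigma> a, tl (support \<sigma> a),
        \<lambda>y. if y \<in> S - cycle_of \<sigma> a then \<sigma> y else y) = \<sigma>"
      unfolding prod.case r_def[symmetric] T_def[symmetric] \<tau>_def[symmetric]
    proof
      fix x
      have rot: "map (cycle_of_list (a # r)) (a # r) = map \<sigma> (a # r)"
        using cyclic_rotation[OF sf(3), of 1] sf(2) by simp
      show "(cycle_of_list (a # r) \<circ> \<tau>) x = \<sigma> x"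
      proof (cases "x \<in> T")
        case True
        then have "cycle_of_list (a # r) x = \<sigma> x" using rot sf(4) unfolding map_eq_conv by auto
        then show ?thesis using True by (simp add: \<tau>_def)
      next
        case False
        show ?thesis
        proof (cases "x \<in> S")
          case True
          then have "\<tau> x \<in> S - T" using False permutes_in_image[OF t] by blast
          then show ?thesis using id_outside_supp[of "\<tau> x" "a # r"] sf(4) st[of x] True False
            by (auto simp del: cycle_of_list.simps)
        next
          assume x: "x \<notin> S"
          then have "\<tau> x = x" "\<sigma> x = x" using permutes_not_in[OF p] by (auto simp: \<tau>_def)
          then show ?thesis using id_outside_supp[of x "a # r"] sf(4) False
            by (auto simp del: cycle_of_list.simps)
        qed
      qed
    qed
    have "odd (card T)" "good (a # r @ [a])" "\<tau> \<in> cperms (S - T)" using sc(2) s by auto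
    then show "(cycle_of \<sigma> a, tl (support \<sigma> a), \<lambda>y. if y \<in> S - cycle_of \<sigma> a then \<sigma> y else y) \<in> ?I"
      unfolding r_def[symmetric] T_def[symmetric] \<tau>_def[symmetric]
      using sf(3,4) TS by (auto simp: rings_def)
    show "?f (cycle_of \<sigma> a, tl (support \<sigma> a), \<lambda>y. if y \<in> S - cycle_of \<sigma> a then \<sigma> y else y) =
        q powi total_turn \<sigma> S"
      unfolding r_def[symmetric] T_def[symmetric] \<tau>_def[symmetric]
      using sc(1) assms(1) by (simp add: power_int_add)
  next
    fix z assume z: "z \<in> ?I"
    obtain T r \<tau> where e: "z = (T, r, \<tau>)" by (metis prod.exhaust)
    have T: "T \<subseteq> S" "a \<in> T" "odd (card T)"
      and r: "distinct (a # r)" "set (a # r) = T" "good (a # r @ [a])"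
      and tau: "\<tau> \<in> cperms (S - T)" using z by (auto simp: e rings_def)
    have t: "\<tau> permutes S - T" using tau by (simp add: cperms_def)
    define \<sigma> where "\<sigma> = cycle_of_list (a # r) \<circ> \<tau>"
    have c: "cycle_of_list (a # r) permutes T" using cycle_permutes[of "a # r"] r(2) by simp
    have p: "\<sigma> permutes S" unfolding \<sigma>_def
      by (rule permutes_compose) (use t c T(1) in \<open>auto intro: permutes_subset\<close>)
    have perm: "permutation \<sigma>" using p assms(2) by (auto simp: permutation_permutes)
    have "map \<sigma> (a # r) = map (cycle_of_list (a # r)) (a # r)"
      unfolding map_eq_conv \<sigma>_def using permutes_not_in[OF t] r(2)
      by (auto simp del: cycle_of_list.simps)
    also have "\<dots> = r @ [a]" using cyclic_rotation[OF r(1), of 1] by simp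
    finally have m: "map \<sigma> (a # r) = r @ [a]" .
    have st: "\<sigma> x = \<tau> x" if "x \<in> S - T" for x
      using id_outside_supp[of "\<tau> x" "a # r"] r(2) permutes_in_image[OF t] that
      by (auto simp: \<sigma>_def simp del: cycle_of_list.simps)
    note fs = follows_support[OF m r(1) perm]
    have s: "\<sigma> \<in> cperms S" using split_cycle(2)[OF assms(2-4) p m r(1,2) T(1) t st] T r tau by simp
    then show "(\<lambda>(T, r, \<tau>). cycle_of_list (a # r) \<circ> \<tau>) z \<in> cperms S" by (simp add: e \<sigma>_def)
    have "(\<lambda>y. if y \<in> S - T then \<sigma> y else y) = \<tau>"
      using st permutes_not_in[OF t] by auto
    then show "(\<lambda>\<sigma>. (cycle_of \<sigma> a, tl (support \<sigma> a), \<lambda>y. if y \<in> S - cycle_of \<sigma> a then \<sigma> y else y))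
        ((\<lambda>(T, r, \<tau>). cycle_of_list (a # r) \<circ> \<tau>) z) = z"
      unfolding e prod.case \<sigma>_def[symmetric] using fs r(2) by simp
  qed
  also have "\<dots> = (\<Sum>T\<in>?T. \<Sum>(r, \<tau>)\<in>rings a T \<times> cperms (S - T).
      q powi \<bar>ht (a # r @ [a])\<bar> * q powi total_turn \<tau> (S - T))"
    using fT assms(2) by (subst sum.Sigma) (auto intro!: finite_cartesian_product finite_cperms)
  also have "\<dots> = (\<Sum>T\<in>?T. (\<Sum>r\<in>rings a T. q powi \<bar>ht (a # r @ [a])\<bar>) * cperm_sum q (S - T))"
    by (simp add: cperm_sum_def sum_product sum.cartesian_product)
  finally show ?thesis .
qed

end

section \<open>Comparing the two factorizations\<close>

lemma conv_comm:
  fixes f g :: "'a set \<Rightarrow> real"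
  shows "(\<Sum>T\<in>Pow S. f T * g (S - T)) = (\<Sum>T\<in>Pow S. g T * f (S - T))"
  by (rule sum.reindex_bij_witness[of _ "\<lambda>T. S - T" "\<lambda>T. S - T"]) (auto simp: double_diff)

text \<open>Insert the recursion for \<open>f\<close> and regroup by the piece \<open>U\<close>
  containing \<open>a\<close>: the part of the convolution with \<open>a\<close> in the first
  argument has the same kernel \<open>R\<close>, followed by the full convolution on
  \<open>S - U\<close>.\<close>

lemma conv_rec:
  fixes f g R :: "'a set \<Rightarrow> real"
  assumes "finite S" "\<And>T. T \<subseteq> S \<Longrightarrow> a \<in> T \<Longrightarrow> f T = (\<Sum>U | U \<subseteq> T \<and> a \<in> U. R U * f (T - U))"
  shows "(\<Sum>T | T \<subseteq> S \<and> a \<in> T. f T * g (S - T)) =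
    (\<Sum>U | U \<subseteq> S \<and> a \<in> U. R U * (\<Sum>T\<in>Pow (S - U). f T * g (S - U - T)))"
proof -
  let ?A = "{T. T \<subseteq> S \<and> a \<in> T}" and ?B = "\<lambda>T. {U. U \<subseteq> T \<and> a \<in> U}"
  have fin: "finite ?A" "\<And>T. T \<subseteq> S \<Longrightarrow> finite (?B T)"
    using assms(1) by (auto intro: finite_subset[of _ "Pow S"])
  have "(\<Sum>T\<in>?A. f T * g (S - T)) = (\<Sum>T\<in>?A. \<Sum>U\<in>?B T. R U * f (T - U) * g (S - T))"
    using assms(2) by (intro sum.cong) (auto simp: sum_distrib_right)
  also have "\<dots> = (\<Sum>(T, U)\<in>Sigma ?A ?B. R U * f (T - U) * g (S - T))"
    using fin by (subst sum.Sigma) auto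
  also have "\<dots> = (\<Sum>(U, T)\<in>Sigma ?A (\<lambda>U. Pow (S - U)). R U * f T * g (S - U - T))"
  proof (rule sum.reindex_bij_witness[of _ "\<lambda>(U, T). (U \<union> T, U)" "\<lambda>(T, U). (U, T - U)"])
    fix z assume "z \<in> Sigma ?A ?B"
    then obtain T U where e: "z = (T, U)" "U \<subseteq> T" "T \<subseteq> S" "a \<in> U" by auto
    then have "S - U - (T - U) = S - T" by auto
    then show "(\<lambda>(U, T). R U * f T * g (S - U - T)) ((\<lambda>(T, U). (U, T - U)) z) =
        (\<lambda>(T, U). R U * f (T - U) * g (S - T)) z" by (simp add: e)
  next
    fix z assume "z \<in> Sigma ?A (\<lambda>U. Pow (S - U))"
    then obtain T U where e: "z = (U, T)" "T \<subseteq> S - U" "U \<subseteq> S" "a \<in> U" by auto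
    then have "U \<union> T - U = T" by auto
    then show "(\<lambda>(T, U). (U, T - U)) ((\<lambda>(U, T). (U \<union> T, U)) z) = z" by (simp add: e)
  qed auto
  also have "\<dots> = (\<Sum>U\<in>?A. \<Sum>T\<in>Pow (S - U). R U * f T * g (S - U - T))"
    using fin assms(1) by (subst sum.Sigma) auto
  also have "\<dots> = (\<Sum>U\<in>?A. R U * (\<Sum>T\<in>Pow (S - U). f T * g (S - U - T)))"
    by (simp add: sum_distrib_left mult.assoc)
  finally show ?thesis .
qed

text \<open>Multiplied by \<open>q ^ M\<close>, both sides are polynomials that agree for all
  \<open>q > 0\<close>, hence are equal. Positive exponents keep the inverse powers below degree
  \<open>M\<close>, so the coefficient at \<open>M + k\<close> with \<open>k > 0\<close> counts the
  fibre over \<open>k\<close>.\<close>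

lemma symmetric_power_sums_determine:
  fixes f :: "'a \<Rightarrow> int" and g :: "'b \<Rightarrow> int"
  assumes "finite X" "finite Y" "\<And>x. x \<in> X \<Longrightarrow> f x > 0" "\<And>y. y \<in> Y \<Longrightarrow> g y > 0"
    and eq: "\<And>q :: real. q > 0 \<Longrightarrow>
      (\<Sum>x\<in>X. q powi f x + inverse q powi f x) = (\<Sum>y\<in>Y. q powi g y + inverse q powi g y)"
  shows "card {x \<in> X. f x = k} = card {y \<in> Y. g y = k}"
proof -
  \<comment> \<open>A bound on all exponents, so that the natural subtraction
    \<open>M - nat i\<close> is exact; inserting 0 covers empty \<open>X\<close> and
    \<open>Y\<close>.\<close>
  define M where "M = Max (insert 0 ((nat \<circ> f) ` X \<union> (nat \<circ> g) ` Y))"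
  have fM: "nat (f x) \<le> M" if "x \<in> X" for x
    unfolding M_def using assms(1,2) that by (intro Max_ge) auto
  have gM: "nat (g y) \<le> M" if "y \<in> Y" for y
    unfolding M_def using assms(1,2) that by (intro Max_ge) auto
  define h :: "int \<Rightarrow> real poly" where "h i = monom 1 (M + nat i) + monom 1 (M - nat i)" for i
  have h: "poly (h i) q = q ^ M * (q powi i + inverse q powi i)" if "q > 0" "nat i \<le> M" "0 < i" for q i
    using that by (simp add: h_def poly_monom power_add power_diff power_int_def field_simps)
  define p where "p = (\<Sum>x\<in>X. h (f x)) - (\<Sum>y\<in>Y. h (g y))"
  have "poly p q = 0" if q: "q > 0" for q
  proof -
    have "poly p q = q ^ M * (\<Sum>x\<in>X. q powi f x + inverse q powi f x) -
        q ^ M * (\<Sum>y\<in>Y. q powi g y + inverse q powi g y)"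
      using h[OF q fM] h[OF q gM] assms(3,4) by (simp add: p_def poly_sum sum_distrib_left)
    then show ?thesis using eq[OF q] by simp
  qed
  then have "{0<..} \<subseteq> {q. poly p q = 0}" by auto
  then have "infinite {q. poly p q = 0}" using infinite_Ioi infinite_super by blast
  then have p0: "p = 0" using poly_roots_finite by blast
  show ?thesis
  proof (cases "k > 0")
    case False
    then have "{x \<in> X. f x = k} = {}" "{y \<in> Y. g y = k} = {}" using assms(3,4) by auto
    then show ?thesis by (metis card.empty)
  next
    case True
    have c: "coeff (h i) (M + nat k) = (if i = k then 1 else 0)" if "0 < i" for i
      using that True by (auto simp: h_def)
    have "(\<Sum>x\<in>X. coeff (h (f x)) (M + nat k)) = (\<Sum>y\<in>Y. coeff (h (g y)) (M + nat k))"
      using arg_cong[OF p0, of "\<lambda>p. coeff p (M + nat k)"] by (simp add: p_def coeff_sum)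
    then have "(\<Sum>x\<in>X. if f x = k then 1 else 0 :: real) = (\<Sum>y\<in>Y. if g y = k then 1 else 0)"
      using c assms(3,4) by simp
    then have "real (card {x \<in> X. f x = k}) = real (card {y \<in> Y. g y = k})"
      using assms(1,2) by (simp add: sum.If_cases Int_def)
    then show ?thesis by simp
  qed
qed

section \<open>Factorization by odd-cycle permutations and comparison with ballot words\<close>

context marked_peaks begin

text \<open>The first letter of a good word is unmarked. This lemma and the next treat sets without
  an unmarked letter, where the recursions have no \<open>a\<close> to start from.\<close>

lemma words_all_peaks:
  assumes "S \<subseteq> K" "S \<noteq> {}"
  shows "words S = {}"
proof (rule ccontr)
  assume "words S \<noteq> {}"
  then obtain w where w: "set w = S" "good w" by (auto simp: words_def)
  then have "w \<noteq> []" using assms by auto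
  then show False using good_ends(1)[OF w(2)] w(1) assms by auto
qed

text \<open>The least element cannot exceed its image.\<close>

lemma cperms_all_peaks:
  assumes "S \<subseteq> K" "S \<noteq> {}" "finite S"
  shows "cperms S = {}"
proof (rule ccontr)
  assume "cperms S \<noteq> {}"
  then obtain \<sigma> where s: "\<sigma> permutes S" "peaks_ok \<sigma> S" by (auto simp: cperms_def)
  have m: "Min S \<in> S" using assms by simp
  then have "\<sigma> (Min S) < Min S" using s(2) assms(1) by (auto simp: peaks_ok_def)
  moreover have "\<sigma> (Min S) \<in> S" using m permutes_in_image[OF s(1)] by simp
  ultimately show False using Min_le[OF assms(3)] by (meson leD)
qed

lemma cperm_sum_empty [simp]: "cperm_sum q {} = 1"
proof -
  have "cperms {} = {id}" by (auto simp: cperms_def peaks_ok_def permutes_empty)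
  then show ?thesis by (simp add: cperm_sum_def total_turn_def)
qed

text \<open>Induction on the size of \<open>S\<close>. In a pair of permutations, the cycle through
  an unmarked \<open>a\<close> lies in the first or in the second one, with weight
  \<open>1/q\<close> or \<open>q\<close> to its absolute turn; the two weights add up to the ring
  weight of \<open>word_sum_rec\<close>.\<close>

lemma word_sum_cperm:
  assumes "q \<noteq> 0" "finite S"
  shows "word_sum q S = (\<Sum>T\<in>Pow S. cperm_sum (inverse q) T * cperm_sum q (S - T))"
  using assms(2)
proof (induction "card S" arbitrary: S rule: less_induct)
  case less
  consider "S = {}" | "S \<noteq> {}" "S \<subseteq> K" | a where "a \<in> S" "a \<notin> K" by blast
  then show ?case
  proof cases
    case 1
    then show ?thesis by (simp add: word_sum_def)
  next
    case 2
    have "cperm_sum (inverse q) T * cperm_sum q (S - T) = 0" if "T \<subseteq> S" for T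
    proof (cases "T = {}")
      case True
      then show ?thesis using cperms_all_peaks[of S] 2 less.prems by (simp add: cperm_sum_def)
    next
      case False
      then have "cperms T = {}"
        using that 2 less.prems by (intro cperms_all_peaks) (auto intro: finite_subset)
      then show ?thesis by (simp add: cperm_sum_def)
    qed
    then have "(\<Sum>T\<in>Pow S. cperm_sum (inverse q) T * cperm_sum q (S - T)) = 0"
      by (intro sum.neutral) blast
    then show ?thesis using words_all_peaks[of S] 2 by (simp add: word_sum_def)
  next
    case 3
    let ?C = "cperm_sum q" and ?C' = "cperm_sum (inverse q)"
    \<comment> \<open>The value 0 on even sets lets the recursion run over all \<open>U\<close>
      containing \<open>a\<close>, as \<open>conv_rec\<close> expects.\<close>
    define R where "R q T = (if odd (card T) then \<Sum>r\<in>rings a T. q powi \<bar>ht (a # r @ [a])\<bar> else 0)"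
      for q :: real and T
    have rec: "cperm_sum s T = (\<Sum>U | U \<subseteq> T \<and> a \<in> U. R s U * cperm_sum s (T - U))"
      if "T \<subseteq> S" "a \<in> T" "s \<noteq> 0" for s T
    proof -
      have fin: "finite T" using that less.prems finite_subset by blast
      have "cperm_sum s T = (\<Sum>U | U \<subseteq> T \<and> a \<in> U \<and> odd (card U). R s U * cperm_sum s (T - U))"
        using cperm_sum_rec[OF that(3) fin that(2) 3(2)] by (simp add: R_def)
      also have "\<dots> = (\<Sum>U | U \<subseteq> T \<and> a \<in> U. R s U * cperm_sum s (T - U))"
        using fin by (intro sum.mono_neutral_left) (auto simp: R_def)
      finally show ?thesis .
    qed
    let ?A = "{U. U \<subseteq> S \<and> a \<in> U}"
    have ih: "(\<Sum>T\<in>Pow (S - U). ?C' T * ?C (S - U - T)) = word_sum q (S - U)" if "U \<in> ?A" for U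
    proof -
      have "card (S - U) < card S" using that less.prems by (intro psubset_card_mono) auto
      then show ?thesis using less.hyps[of "S - U"] less.prems by simp
    qed
    have "(\<Sum>T\<in>Pow S. ?C' T * ?C (S - T)) =
        (\<Sum>T\<in>?A \<union> {T. T \<subseteq> S \<and> a \<notin> T}. ?C' T * ?C (S - T))"
      by (rule sum.cong) auto
    also have "\<dots> = (\<Sum>T\<in>?A. ?C' T * ?C (S - T)) + (\<Sum>T | T \<subseteq> S \<and> a \<notin> T. ?C' T * ?C (S - T))"
      using less.prems by (intro sum.union_disjoint) auto
    \<comment> \<open>Complementation brings the factor containing \<open>a\<close> to the
      front.\<close>
    also have "(\<Sum>T | T \<subseteq> S \<and> a \<notin> T. ?C' T * ?C (S - T)) = (\<Sum>T\<in>?A. ?C T * ?C' (S - T))"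
      using 3(1)
      by (intro sum.reindex_bij_witness[of _ "\<lambda>T. S - T" "\<lambda>T. S - T"]) (auto simp: double_diff)
    also have "\<dots> = (\<Sum>U\<in>?A. R q U * word_sum q (S - U))"
      using conv_rec[of S a ?C "R q" ?C'] less.prems rec assms(1) ih
        conv_comm[of ?C' ?C] by simp
    also have "(\<Sum>T\<in>?A. ?C' T * ?C (S - T)) = (\<Sum>U\<in>?A. R (inverse q) U * word_sum q (S - U))"
      using conv_rec[of S a ?C' "R (inverse q)" ?C] less.prems rec assms(1) ih by simp
    also have "(\<Sum>U\<in>?A. R (inverse q) U * word_sum q (S - U)) + (\<Sum>U\<in>?A. R q U * word_sum q (S - U)) =
        (\<Sum>U\<in>?A. (R (inverse q) U + R q U) * word_sum q (S - U))"
      by (simp add: sum.distrib distrib_right)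
    also have "\<dots> = (\<Sum>U | U \<subseteq> S \<and> a \<in> U \<and> odd (card U).
        (R (inverse q) U + R q U) * word_sum q (S - U))"
      using less.prems by (intro sum.mono_neutral_right) (auto simp: R_def)
    also have "\<dots> = word_sum q S"
      unfolding word_sum_rec[OF assms(1) less.prems 3]
    proof (rule sum.cong[OF refl])
      fix U assume U: "U \<in> {U. U \<subseteq> S \<and> a \<in> U \<and> odd (card U)}"
      \<comment> \<open>Removing the absolute value at most swaps the two summands.\<close>
      have "inverse q powi \<bar>i\<bar> + q powi \<bar>i\<bar> = q powi i + q powi (- i)" for i :: int
        by (cases "i \<ge> 0") (auto simp: power_int_inverse power_int_minus)
      then have "R (inverse q) U + R q U =
          (\<Sum>r\<in>rings a U. q powi ht (a # r @ [a]) + q powi (- ht (a # r @ [a])))"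
        using U by (simp add: R_def sum.distrib[symmetric])
      then show "(R (inverse q) U + R q U) * word_sum q (S - U) =
          (\<Sum>r\<in>rings a U. q powi ht (a # r @ [a]) + q powi (- ht (a # r @ [a]))) * word_sum q (S - U)"
        by simp
    qed
    finally show ?thesis by simp
  qed
qed

text \<open>The turn of an odd cycle is odd, hence nonzero.\<close>

lemma total_turn_pos:
  assumes "\<sigma> \<in> cperms S" "finite S" "S \<noteq> {}"
  shows "total_turn \<sigma> S > 0"
proof -
  have "\<bar>turn \<sigma> C\<bar> > 0" if "C \<in> cycle_of \<sigma> ` S" for C
  proof -
    have "odd (card C)" using assms(1) that by (auto simp: cperms_def)
    then have "odd (turn \<sigma> C)" by (simp add: turn_def)
    then show ?thesis by auto
  qed
  then show ?thesis unfolding total_turn_def using assms(2,3) by (intro sum_pos) auto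
qed

text \<open>In the two factorizations of \<open>word_sum\<close> the summands for proper nonempty
  \<open>T\<close> agree by induction. What remains is an identity symmetric under \<open>q\<close>
  and \<open>1/q\<close>, from which positive exponents recover the fibre sizes.\<close>

lemma card_cperms_eq_ballots:
  assumes "finite S" "S \<noteq> {}"
  shows "card {\<sigma> \<in> cperms S. total_turn \<sigma> S = k} = card {w \<in> ballots S. ht w + 1 = k}"
proof -
  have eq: "cperm_sum q S + cperm_sum (inverse q) S = ballot_sum q S + ballot_sum (inverse q) S"
    if S: "finite S" "S \<noteq> {}" "q > 0"
      and IH: "\<And>T q. T \<subset> S \<Longrightarrow> q > 0 \<Longrightarrow> cperm_sum q T = ballot_sum q T" for S and q :: real
  proof -
    have *: "(\<Sum>T\<in>Pow S. f (inverse q) T * f q (S - T)) = f q S + f (inverse q) S +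
        (\<Sum>T\<in>Pow S - {{}, S}. f (inverse q) T * f q (S - T))"
      if "f q {} = 1" "f (inverse q) {} = 1" for f :: "real \<Rightarrow> nat set \<Rightarrow> real"
    proof -
      have "Pow S = insert {} (insert S (Pow S - {{}, S}))" by auto
      then have "(\<Sum>T\<in>Pow S. f (inverse q) T * f q (S - T)) =
          (\<Sum>T\<in>insert {} (insert S (Pow S - {{}, S})). f (inverse q) T * f q (S - T))" by simp
      also have "\<dots> = f q S + (f (inverse q) S +
          (\<Sum>T\<in>Pow S - {{}, S}. f (inverse q) T * f q (S - T)))"
        using S that by (subst sum.insert; simp)
      finally show ?thesis by simp
    qed
    have "(\<Sum>T\<in>Pow S - {{}, S}. cperm_sum (inverse q) T * cperm_sum q (S - T)) =
        (\<Sum>T\<in>Pow S - {{}, S}. ballot_sum (inverse q) T * ballot_sum q (S - T))"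
    proof (rule sum.cong[OF refl])
      fix T assume "T \<in> Pow S - {{}, S}"
      then have "T \<subset> S" "S - T \<subset> S" by auto
      then show "cperm_sum (inverse q) T * cperm_sum q (S - T) =
          ballot_sum (inverse q) T * ballot_sum q (S - T)" using IH S(3) by simp
    qed
    moreover have "(\<Sum>T\<in>Pow S. cperm_sum (inverse q) T * cperm_sum q (S - T)) =
        (\<Sum>T\<in>Pow S. ballot_sum (inverse q) T * ballot_sum q (S - T))"
      using word_sum_cperm[of q S] word_sum_ballot[of q S] S by simp
    ultimately show ?thesis using *[of cperm_sum] *[of ballot_sum] by (simp add: ballot_sum_def)
  qed
  have fib: "\<And>k. card {\<sigma> \<in> cperms S. total_turn \<sigma> S = k} = card {w \<in> ballots S. ht w + 1 = k}"
    if S: "finite S" "S \<noteq> {}"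
      and IH: "\<And>T q. T \<subset> S \<Longrightarrow> q > 0 \<Longrightarrow> cperm_sum q T = ballot_sum q T" for S
  proof (rule symmetric_power_sums_determine)
    show "finite (cperms S)" by (rule finite_cperms[OF S(1)])
    show "finite (ballots S)" by (simp add: ballots_def)
    show "total_turn \<sigma> S > 0" if "\<sigma> \<in> cperms S" for \<sigma> by (rule total_turn_pos[OF that S])
    show "ht w + 1 > 0" if "w \<in> ballots S" for w
    proof -
      have "w \<noteq> []" "starts_min w" using that S by (auto simp: ballots_def words_def)
      then have "0 \<le> ht w" unfolding starts_min_def by auto
      then show ?thesis by simp
    qed
    show "(\<Sum>\<sigma>\<in>cperms S. q powi total_turn \<sigma> S + inverse q powi total_turn \<sigma> S) =
        (\<Sum>w\<in>ballots S. q powi (ht w + 1) + inverse q powi (ht w + 1))" if "q > 0" for q :: real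
      using eq[OF S that IH] S by (simp add: cperm_sum_def ballot_sum_def sum.distrib)
  qed
  have all: "cperm_sum q S = ballot_sum q S" if "finite S" "q > 0" for S q
    using that
  proof (induction "card S" arbitrary: S q rule: less_induct)
    case less
    show ?case
    proof (cases "S = {}")
      case True
      then show ?thesis by (simp add: ballot_sum_def)
    next
      case False
      have IH: "cperm_sum q T = ballot_sum q T" if "T \<subset> S" "q > 0" for T q
        using less.hyps[of T q] that less.prems by (auto intro: psubset_card_mono finite_subset)
      note F = fib[OF less.prems(1) False IH]
      \<comment> \<open>Group by exponent; indices contributed only by \<open>A\<close> have empty
        fibres, so both sums can run over the same set of exponents.\<close>
      have img: "sum h X = (\<Sum>k\<in>f ` X \<union> A. real (card {x \<in> X. f x = k}) * q powi k)"
        if "finite X" "finite A" "\<And>x. h x = q powi f x" for X and h :: "'b \<Rightarrow> real" and f :: "'b \<Rightarrow> int" and A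
      proof -
        have "sum h X = (\<Sum>k\<in>f ` X \<union> A. sum h {x \<in> X. f x = k})"
          using that by (intro sum.group[symmetric]) auto
        then show ?thesis using that(3) by simp
      qed
      have "cperm_sum q S = (\<Sum>k\<in>(\<lambda>\<sigma>. total_turn \<sigma> S) ` cperms S \<union> (\<lambda>w. ht w + 1) ` ballots S.
          real (card {\<sigma> \<in> cperms S. total_turn \<sigma> S = k}) * q powi k)"
        unfolding cperm_sum_def using finite_cperms[OF less.prems(1)]
        by (intro img) (auto simp: ballots_def)
      also have "\<dots> = (\<Sum>k\<in>(\<lambda>w. ht w + 1) ` ballots S \<union> (\<lambda>\<sigma>. total_turn \<sigma> S) ` cperms S.
          real (card {w \<in> ballots S. ht w + 1 = k}) * q powi k)"
        using F by (intro sum.cong) auto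
      also have "\<dots> = (\<Sum>w\<in>ballots S. q powi (ht w + 1))"
        using finite_cperms[OF less.prems(1)] by (intro img[symmetric]) (auto simp: ballots_def)
      finally show ?thesis using False by (simp add: ballot_sum_def)
    qed
  qed
  show ?thesis using fib[OF assms all] finite_subset assms(1) by blast
qed

end

section \<open>From marked peaks to exact peak sets\<close>

text \<open>Inclusion-exclusion as an induction on \<open>card (U - P)\<close>: a superset count is
  the sum of exact counts, and those of proper supersets of \<open>P\<close> are already known to
  agree.\<close>

lemma exact_from_superset_counts:
  fixes F :: "'a \<Rightarrow> 'c set" and G :: "'b \<Rightarrow> 'c set"
  assumes "finite X" "finite Y" "\<And>x. x \<in> X \<Longrightarrow> finite (F x)" "\<And>y. y \<in> Y \<Longrightarrow> finite (G y)"
    and eq: "\<And>P. card {x \<in> X. P \<subseteq> F x} = card {y \<in> Y. P \<subseteq> G y}"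
  shows "card {x \<in> X. F x = P} = card {y \<in> Y. G y = P}"
proof -
  define U where "U = (\<Union>x\<in>X. F x) \<union> (\<Union>y\<in>Y. G y)"
  have fU: "finite U" using assms by (auto simp: U_def)
  have FU: "F x \<subseteq> U" if "x \<in> X" for x using that by (auto simp: U_def)
  have GU: "G y \<subseteq> U" if "y \<in> Y" for y using that by (auto simp: U_def)
  have split: "card {z \<in> Z. P \<subseteq> H z} = (\<Sum>Q | P \<subseteq> Q \<and> Q \<subseteq> U. card {z \<in> Z. H z = Q})"
    if "finite Z" "\<And>z. z \<in> Z \<Longrightarrow> H z \<subseteq> U" for Z :: "'z set" and H P
  proof -
    have "card {z \<in> Z. P \<subseteq> H z} = card (\<Union>Q\<in>{Q. P \<subseteq> Q \<and> Q \<subseteq> U}. {z \<in> Z. H z = Q})"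
      using that by (intro arg_cong[of _ _ card]) auto
    also have "\<dots> = (\<Sum>Q | P \<subseteq> Q \<and> Q \<subseteq> U. card {z \<in> Z. H z = Q})"
      using that fU by (intro card_UN_disjoint) (auto intro: finite_subset[of _ "Pow U"])
    finally show ?thesis .
  qed
  show ?thesis
  proof (cases "P \<subseteq> U")
    case False
    then have "{x \<in> X. F x = P} = {}" "{y \<in> Y. G y = P} = {}" using FU GU by auto
    then show ?thesis by (metis card.empty)
  next
    case True
    then show ?thesis
    proof (induction "card (U - P)" arbitrary: P rule: less_induct)
      case less
      let ?Q = "{Q. P \<subseteq> Q \<and> Q \<subseteq> U}"
      have fQ: "finite ?Q" using fU by (auto intro: finite_subset[of _ "Pow U"])
      have P: "P \<in> ?Q" using less.prems by simp
      have "(\<Sum>Q\<in>?Q. card {x \<in> X. F x = Q}) = (\<Sum>Q\<in>?Q. card {y \<in> Y. G y = Q})"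
        using eq[of P] split[OF assms(1) FU] split[OF assms(2) GU] by simp
      moreover have "(\<Sum>Q\<in>?Q - {P}. card {x \<in> X. F x = Q}) = (\<Sum>Q\<in>?Q - {P}. card {y \<in> Y. G y = Q})"
      proof (rule sum.cong[OF refl])
        fix Q assume Q: "Q \<in> ?Q - {P}"
        then have "U - Q \<subset> U - P" by auto
        then have "card (U - Q) < card (U - P)" using fU by (intro psubset_card_mono) auto
        then show "card {x \<in> X. F x = Q} = card {y \<in> Y. G y = Q}" using less.hyps Q by auto
      qed
      ultimately show ?case
        using sum.remove[OF fQ P, of "\<lambda>Q. card {x \<in> X. F x = Q}"]
          sum.remove[OF fQ P, of "\<lambda>Q. card {y \<in> Y. G y = Q}"] by linarith
    qed
  qed
qed

text \<open>Bijections between fibres of equal size are glued together.\<close>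

lemma bij_betw_from_fibre_cards:
  assumes "finite X" "finite Y" "\<And>k. card {x \<in> X. f x = k} = card {y \<in> Y. g y = k}"
  shows "\<exists>h. bij_betw h X Y \<and> (\<forall>x\<in>X. g (h x) = f x)"
proof -
  have "\<exists>h. bij_betw h {x \<in> X. f x = k} {y \<in> Y. g y = k}" for k
    using assms by (intro finite_same_card_bij) auto
  then obtain h where h: "bij_betw (h k) {x \<in> X. f x = k} {y \<in> Y. g y = k}" for k by metis
  define H where "H x = h (f x) x" for x
  have H: "H x \<in> Y \<and> g (H x) = f x" if "x \<in> X" for x
    using bij_betwE[OF h[of "f x"]] that by (auto simp: H_def)
  have "inj_on H X"
  proof (rule inj_onI)
    fix x y assume xy: "x \<in> X" "y \<in> X" "H x = H y"
    then have "f x = f y" using H by metis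
    then show "x = y" using xy bij_betw_imp_inj_on[OF h[of "f x"]] by (auto simp: H_def inj_on_def)
  qed
  moreover have "H ` X = Y"
  proof
    show "H ` X \<subseteq> Y" using H by auto
    show "Y \<subseteq> H ` X"
    proof
      fix y assume y: "y \<in> Y"
      then have "y \<in> h (g y) ` {x \<in> X. f x = g y}" using bij_betw_imp_surj_on[OF h[of "g y"]] by auto
      then obtain x where "x \<in> X" "y = H x" by (auto simp: H_def)
      then show "y \<in> H ` X" by blast
    qed
  qed
  ultimately show ?thesis using H unfolding bij_betw_def by blast
qed

section \<open>Permutations as words\<close>

definition word_of :: "nat \<Rightarrow> (nat \<Rightarrow> nat) \<Rightarrow> nat list" where
  "word_of n p = map p [1..<Suc n]"

lemma length_word_of [simp]: "length (word_of n p) = n"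
  by (simp add: word_of_def)

lemma nth_word_of: "i < n \<Longrightarrow> word_of n p ! i = p (Suc i)"
  by (simp add: word_of_def del: upt_Suc)

lemma bij_betw_word_of: "bij_betw (word_of n) (perms n) {w. distinct w \<and> set w = {1..n}}"
proof -
  have "inj_on (word_of n) (perms n)"
  proof (rule inj_onI)
    fix p p' assume p: "p \<in> perms n" "p' \<in> perms n" and e: "word_of n p = word_of n p'"
    show "p = p'"
    proof
      fix x show "p x = p' x"
      proof (cases "x \<in> {1..n}")
        case True
        then have "p x = word_of n p ! (x - 1)" "p' x = word_of n p' ! (x - 1)"
          by (auto simp: nth_word_of)
        then show ?thesis using e by simp
      next
        case False
        then show ?thesis using p by (auto simp: perms_def permutes_not_in)
      qed
    qed
  qed
  moreover have "word_of n ` perms n = {w. distinct w \<and> set w = {1..n}}"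
  proof
    show "word_of n ` perms n \<subseteq> {w. distinct w \<and> set w = {1..n}}"
    proof
      fix w assume "w \<in> word_of n ` perms n"
      then obtain p where p: "p permutes {1..n}" "w = word_of n p" by (auto simp: perms_def)
      have s: "set [1..<Suc n] = {1..n}" by auto
      have "distinct w" unfolding p word_of_def distinct_map
        using permutes_inj_on[OF p(1)] by (simp del: upt_Suc)
      moreover have "set w = {1..n}" unfolding p word_of_def set_map s by (rule permutes_image[OF p(1)])
      ultimately show "w \<in> {w. distinct w \<and> set w = {1..n}}" by simp
    qed
    show "{w. distinct w \<and> set w = {1..n}} \<subseteq> word_of n ` perms n"
    proof clarify
      fix w :: "nat list" assume w: "distinct w" "set w = {1..n}"
      have l: "length w = n" using distinct_card[OF w(1)] w(2) by simp
      define p where "p i = (if i \<in> {1..n} then w ! (i - 1) else i)" for i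
      have "bij_betw p {1..n} {1..n}"
      proof (rule bij_betw_imageI)
        show "inj_on p {1..n}"
        proof (rule inj_onI)
          fix i j assume "i \<in> {1..n}" "j \<in> {1..n}" "p i = p j"
          then have "i - 1 = j - 1" using nth_eq_iff_index_eq[OF w(1), of "i - 1" "j - 1"] l
            by (auto simp: p_def)
          then show "i = j" using \<open>i \<in> {1..n}\<close> \<open>j \<in> {1..n}\<close> by auto
        qed
        have "p ` {1..n} = (\<lambda>i. w ! i) ` {..<n}"
        proof
          show "p ` {1..n} \<subseteq> (\<lambda>i. w ! i) ` {..<n}" by (auto simp: p_def)
          show "(\<lambda>i. w ! i) ` {..<n} \<subseteq> p ` {1..n}"
          proof clarify
            fix i assume "i < n"
            then have "w ! i = p (Suc i)" "Suc i \<in> {1..n}" by (auto simp: p_def)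
            then show "w ! i \<in> p ` {1..n}" by auto
          qed
        qed
        also have "\<dots> = set w" unfolding set_conv_nth l by auto
        finally show "p ` {1..n} = {1..n}" using w(2) by simp
      qed
      then have "p permutes {1..n}" by (rule bij_imp_permutes) (unfold p_def, rule if_not_P)
      moreover have "word_of n p = w"
        by (rule nth_equalityI) (auto simp: l nth_word_of p_def)
      ultimately show "w \<in> word_of n ` perms n" by (auto simp: perms_def)
    qed
  qed
  ultimately show ?thesis by (simp add: bij_betw_def)
qed

text \<open>Stated for all prefix lengths, as the ballot condition involves them. The second
  equation makes \<open>des\<close> a function of the height.\<close>

lemma ht_word_of:
  assumes "p \<in> perms n" "m \<le> n"
  shows "ht (word_of m p) = int (asc m p) - int (des m p)" "asc m p + des m p = m - 1"
proof -
  have "int (asc m p) - int (des m p) = ht (word_of m p) \<and> asc m p + des m p = m - 1"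
    using assms(2)
  proof (induction m)
    case 0
    then show ?case by (simp add: asc_def des_def word_of_def)
  next
    case (Suc m)
    show ?case
    proof (cases m)
      case 0
      then show ?thesis by (simp add: asc_def des_def word_of_def)
    next
      case (Suc m')
      then have m: "m \<ge> 1" by simp
      have fin: "finite {i \<in> {1..<m}. p i < p (Suc i)}" "finite {i \<in> {1..<m}. p i > p (Suc i)}" by auto
      have "inj p" using assms(1) by (auto simp: perms_def permutes_inj)
      then have ne: "p m \<noteq> p (Suc m)" by (auto simp: inj_eq)
      have "{i \<in> {1..<Suc m}. p i < p (Suc i)} =
          (if p m < p (Suc m) then insert m {i \<in> {1..<m}. p i < p (Suc i)} else {i \<in> {1..<m}. p i < p (Suc i)})"
        using m by (auto simp: less_Suc_eq)
      then have a: "asc (Suc m) p = asc m p + (if p m < p (Suc m) then 1 else 0)"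
        unfolding asc_def using fin by simp
      have "{i \<in> {1..<Suc m}. p i > p (Suc i)} =
          (if p m > p (Suc m) then insert m {i \<in> {1..<m}. p i > p (Suc i)} else {i \<in> {1..<m}. p i > p (Suc i)})"
        using m by (auto simp: less_Suc_eq)
      then have d: "des (Suc m) p = des m p + (if p m > p (Suc m) then 1 else 0)"
        unfolding des_def using fin by simp
      have w: "word_of (Suc m) p = word_of m p @ [p (Suc m)]" by (simp add: word_of_def)
      have ne0: "word_of m p \<noteq> []" using m length_word_of[of m p] by (metis list.size(3) not_one_le_zero)
      have l: "last (word_of m p) = p m"
        using ne0 nth_word_of[of "m - 1" m p] m by (simp add: last_conv_nth)
      have h: "ht (word_of (Suc m) p) = ht (word_of m p) + step (p m) (p (Suc m))"
        unfolding w using ht_append[OF ne0, of "[p (Suc m)]"] l by simp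
      show ?thesis using Suc.IH Suc.prems ne m unfolding a d h by (auto simp: step_def)
    qed
  qed
  then show "ht (word_of m p) = int (asc m p) - int (des m p)" "asc m p + des m p = m - 1" by auto
qed

lemma starts_min_word_of:
  assumes "p \<in> perms n"
  shows "starts_min (word_of n p) \<longleftrightarrow> (\<forall>m\<in>{1..n}. des m p \<le> asc m p)"
proof -
  have t: "take m (word_of n p) = word_of m p" if "m \<le> n" for m
    using that by (intro nth_equalityI) (auto simp: nth_word_of)
  show ?thesis
  proof
    assume s: "starts_min (word_of n p)"
    show "\<forall>m\<in>{1..n}. des m p \<le> asc m p"
    proof
      fix m assume m: "m \<in> {1..n}"
      have "word_of n p = word_of m p @ drop m (word_of n p)"
        using t[of m] m append_take_drop_id[of m "word_of n p"] by simp
      moreover have "word_of m p \<noteq> []" using m length_word_of[of m p] by (auto simp del: length_word_of)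
      ultimately have "0 \<le> ht (word_of m p)" using s unfolding starts_min_def by blast
      then show "des m p \<le> asc m p" using ht_word_of(1)[OF assms, of m] m by simp
    qed
  next
    assume h: "\<forall>m\<in>{1..n}. des m p \<le> asc m p"
    show "starts_min (word_of n p)" unfolding starts_min_def
    proof (intro allI impI)
      fix u v assume e: "word_of n p = u @ v" and u: "u \<noteq> []"
      have l: "n = length u + length v" using arg_cong[OF e, of length] by simp
      then have "u = word_of (length u) p" using t[of "length u"] e by simp
      moreover have "length u \<in> {1..n}" using l u by (cases u) auto
      ultimately show "0 \<le> ht u" using h ht_word_of(1)[OF assms, of "length u"] l by force
    qed
  qed
qed

section \<open>Peak sets as marked letters with prescribed neighbors\<close>

definition peak_letters :: "(nat \<times> nat set) set \<Rightarrow> nat set" where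
  "peak_letters P = fst ` P"

text \<open>Meaningful only if \<open>P\<close> is functional and \<open>b\<close> occurs in it.\<close>

definition peak_nbrs :: "(nat \<times> nat set) set \<Rightarrow> nat \<Rightarrow> nat set" where
  "peak_nbrs P b = (THE X. (b, X) \<in> P)"

text \<open>Peak sets prescribe one neighbor set per letter; any other \<open>P\<close> is contained
  in none of them.\<close>

definition functional :: "('a \<times> 'b) set \<Rightarrow> bool" where
  "functional P \<longleftrightarrow> (\<forall>b X Y. (b, X) \<in> P \<longrightarrow> (b, Y) \<in> P \<longrightarrow> X = Y)"

lemma functional_subset: "P \<subseteq> Q \<Longrightarrow> functional Q \<Longrightarrow> functional P"
  unfolding functional_def by blast

lemma peak_nbrs_eq: "functional P \<Longrightarrow> (b, X) \<in> P \<Longrightarrow> peak_nbrs P b = X"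
  unfolding peak_nbrs_def functional_def by (rule the_equality) blast+

lemma functional_PEAK:
  assumes "p \<in> perms n"
  shows "functional (PEAK n p)"
proof -
  have "inj p" using assms by (auto simp: perms_def permutes_inj)
  then show ?thesis unfolding functional_def PEAK_def by (auto dest: injD)
qed

lemma functional_cPEAK: "functional (cPEAK n \<sigma>)"
  unfolding functional_def cPEAK_def by auto

lemma good_word_of:
  assumes p: "p \<in> perms n" and f: "functional P" and s: "peak_letters P \<subseteq> {1..n}"
  shows "marked_peaks.good (peak_letters P) (peak_nbrs P) (word_of n p) \<longleftrightarrow> P \<subseteq> PEAK n p"
proof -
  interpret marked_peaks "peak_letters P" "peak_nbrs P" .
  have perm: "p permutes {1..n}" using p by (simp add: perms_def)
  \<comment> \<open>The zero-based list position \<open>l\<close> is position \<open>Suc l\<close>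
    of the permutation, so the neighbors sit at \<open>l\<close> and
    \<open>Suc (Suc l)\<close>.\<close>
  have nb: "last xs = p l \<and> b = p (Suc l) \<and> hd ys = p (Suc (Suc l)) \<and> 0 < l \<and> Suc l < n"
    if e: "word_of n p = xs @ b # ys" and ne: "xs \<noteq> []" "ys \<noteq> []" and l: "l = length xs" for xs b ys l
  proof -
    have n: "n = length xs + 1 + length ys" using arg_cong[OF e, of length] by simp
    have l0: "0 < l" "0 < length ys" using ne l by auto
    have "last xs = word_of n p ! (l - 1)" unfolding e using ne l l0 by (simp add: last_conv_nth nth_append)
    moreover have "b = word_of n p ! l" unfolding e using l by simp
    moreover have "hd ys = word_of n p ! Suc l" unfolding e using l ne by (simp add: hd_conv_nth nth_append)
    ultimately show ?thesis using n l l0 by (simp add: nth_word_of)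
  qed
  show ?thesis
  proof
    assume g: "good (word_of n p)"
    show "P \<subseteq> PEAK n p"
    proof clarify
      fix b X assume bX: "(b, X) \<in> P"
      then have b: "b \<in> peak_letters P" by (force simp: peak_letters_def)
      then have "b \<in> set (word_of n p)" using s bij_betwE[OF bij_betw_word_of] p by blast
      then obtain xs ys where e: "word_of n p = xs @ b # ys" by (meson split_list)
      note G = goodD[OF g[unfolded e] b]
      have X: "X = {last xs, hd ys}" using G(5) peak_nbrs_eq[OF f bX] by simp
      note N = nb[OF e G(1,2) refl]
      have "1 < Suc (length xs) \<and> Suc (length xs) < n \<and> p (Suc (length xs) - 1) < p (Suc (length xs)) \<and>
          p (Suc (length xs)) > p (Suc (Suc (length xs)))"
        using N G(3,4) by simp
      moreover have "(b, X) = (p (Suc (length xs)), {p (Suc (length xs) - 1), p (Suc (Suc (length xs)))})"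
        using N X by simp
      ultimately show "(b, X) \<in> PEAK n p" unfolding PEAK_def by blast
    qed
  next
    assume sub: "P \<subseteq> PEAK n p"
    show "good (word_of n p)" unfolding good_def
    proof (intro allI impI)
      fix xs b ys assume e: "word_of n p = xs @ b # ys" and b: "b \<in> peak_letters P"
      then obtain X where bX: "(b, X) \<in> P" by (auto simp: peak_letters_def)
      then obtain l where l: "b = p l" "X = {p (l - 1), p (Suc l)}" "1 < l" "l < n"
          "p (l - 1) < p l" "p l > p (Suc l)" using sub unfolding PEAK_def by blast
      have n: "n = length xs + 1 + length ys" using arg_cong[OF e, of length] by simp
      have "b = word_of n p ! length xs" unfolding e by simp
      then have "b = p (Suc (length xs))" using n by (simp add: nth_word_of)
      then have ll: "l = Suc (length xs)" using l(1) injD[OF permutes_inj[OF perm]] by metis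
      have ne: "xs \<noteq> []" "ys \<noteq> []" using l(3,4) ll n by auto
      note N = nb[OF e ne refl]
      show "xs \<noteq> [] \<and> ys \<noteq> [] \<and> last xs < b \<and> hd ys < b \<and> peak_nbrs P b = {last xs, hd ys}"
        using ne N l ll peak_nbrs_eq[OF f bX] by auto
    qed
  qed
qed

lemma peaks_ok_cPEAK:
  assumes f: "functional P" and s: "peak_letters P \<subseteq> {1..n}"
  shows "marked_peaks.peaks_ok (peak_letters P) (peak_nbrs P) \<sigma> {1..n} \<longleftrightarrow> P \<subseteq> cPEAK n \<sigma>"
  unfolding marked_peaks.peaks_ok_def
proof
  assume h: "\<forall>b\<in>peak_letters P \<inter> {1..n}. inv \<sigma> b < b \<and> \<sigma> b < b \<and> peak_nbrs P b = {inv \<sigma> b, \<sigma> b}"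
  show "P \<subseteq> cPEAK n \<sigma>"
  proof clarify
    fix b X assume bX: "(b, X) \<in> P"
    then have b: "b \<in> peak_letters P \<inter> {1..n}" using s by (force simp: peak_letters_def)
    show "(b, X) \<in> cPEAK n \<sigma>"
      using h[rule_format, OF b] b peak_nbrs_eq[OF f bX] by (auto simp: cPEAK_def)
  qed
next
  assume sub: "P \<subseteq> cPEAK n \<sigma>"
  show "\<forall>b\<in>peak_letters P \<inter> {1..n}. inv \<sigma> b < b \<and> \<sigma> b < b \<and> peak_nbrs P b = {inv \<sigma> b, \<sigma> b}"
  proof
    fix b assume "b \<in> peak_letters P \<inter> {1..n}"
    then obtain X where bX: "(b, X) \<in> P" by (auto simp: peak_letters_def)
    then show "inv \<sigma> b < b \<and> \<sigma> b < b \<and> peak_nbrs P b = {inv \<sigma> b, \<sigma> b}"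
      using sub peak_nbrs_eq[OF f bX] by (auto simp: cPEAK_def)
  qed
qed

text \<open>The cycles partition \<open>{1..n}\<close>, and a cycle has length
  \<open>\<bar>casc - cdes\<bar> + 2 * min casc cdes\<close>.\<close>

lemma total_turn_exc_tilde:
  assumes "\<sigma> \<in> odd_perms n"
  shows "int n = total_turn \<sigma> {1..n} + 2 * int (exc_tilde n \<sigma>)"
proof -
  have p: "\<sigma> permutes {1..n}" and odd: "\<And>C. C \<in> cycle_of \<sigma> ` {1..n} \<Longrightarrow> odd (card C)"
    using assms by (auto simp: odd_perms_def perms_def cycles_def)
  have perm: "permutation \<sigma>" using p by (auto simp: permutation_permutes)
  have sub: "cycle_of \<sigma> x \<subseteq> {1..n}" if "x \<in> {1..n}" for x
    using cycle_of_cong(2)[of x "{1..n}" \<sigma> \<sigma>] that permutes_in_image[OF p] by blast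
  have un: "\<Union> (cycle_of \<sigma> ` {1..n}) = {1..n}" using sub self_in_cycle_of by blast
  have "card (\<Union> (cycle_of \<sigma> ` {1..n})) = (\<Sum>C\<in>cycle_of \<sigma> ` {1..n}. card C)"
  proof (rule card_Union_disjoint)
    show "pairwise disjnt (cycle_of \<sigma> ` {1..n})"
      unfolding pairwise_def disjnt_def using cycle_of_eq[OF perm] by (metis disjoint_iff imageE)
    show "finite A" if "A \<in> cycle_of \<sigma> ` {1..n}" for A using that sub finite_subset by blast
  qed
  then have n: "n = (\<Sum>C\<in>cycle_of \<sigma> ` {1..n}. card C)" using un by simp
  have "int (card C) = \<bar>turn \<sigma> C\<bar> + 2 * int (min (casc \<sigma> C) (cdes \<sigma> C))"
    if C: "C \<in> cycle_of \<sigma> ` {1..n}" for C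
  proof -
    have "finite C" using C sub finite_subset by blast
    then have "casc \<sigma> C \<le> card C" unfolding casc_def by (intro card_mono) auto
    then show ?thesis by (simp add: turn_def cdes_def)
  qed
  then have "(\<Sum>C\<in>cycle_of \<sigma> ` {1..n}. int (card C)) =
      (\<Sum>C\<in>cycle_of \<sigma> ` {1..n}. \<bar>turn \<sigma> C\<bar> + 2 * int (min (casc \<sigma> C) (cdes \<sigma> C)))"
    by (rule sum.cong[OF refl])
  then show ?thesis
    by (subst n) (simp add: total_turn_def exc_tilde_def cycles_def sum.distrib sum_distrib_left)
qed

lemma card_superset_counts:
  assumes "n \<ge> 1"
  shows "card {p \<in> ballot n. des n p = d \<and> P \<subseteq> PEAK n p} =
    card {\<sigma> \<in> odd_perms n. exc_tilde n \<sigma> = d \<and> P \<subseteq> cPEAK n \<sigma>}"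
proof (cases "functional P \<and> peak_letters P \<subseteq> {1..n}")
  case False
  \<comment> \<open>An inconsistent or out-of-range \<open>P\<close> lies in no peak set of either
    kind, so both counts vanish.\<close>
  have "\<not> P \<subseteq> PEAK n p" if "p \<in> ballot n" for p
  proof
    assume sub: "P \<subseteq> PEAK n p"
    have p: "p \<in> perms n" using that by (simp add: ballot_def)
    then have "p permutes {1..n}" by (simp add: perms_def)
    then have "p l \<in> {1..n}" if "1 < l" "l < n" for l using that permutes_in_image[of p "{1..n}" l] by simp
    then have "fst ` PEAK n p \<subseteq> {1..n}" unfolding PEAK_def by auto
    then have "peak_letters P \<subseteq> {1..n}" using sub unfolding peak_letters_def by blast
    then show False using False functional_subset[OF sub functional_PEAK[OF p]] by blast
  qed
  moreover have "\<not> P \<subseteq> cPEAK n \<sigma>" for \<sigma>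
  proof
    assume sub: "P \<subseteq> cPEAK n \<sigma>"
    have "fst ` cPEAK n \<sigma> \<subseteq> {1..n}" unfolding cPEAK_def by auto
    then have "peak_letters P \<subseteq> {1..n}" using sub unfolding peak_letters_def by blast
    then show False using False functional_subset[OF sub functional_cPEAK] by blast
  qed
  ultimately have "{p \<in> ballot n. des n p = d \<and> P \<subseteq> PEAK n p} = {}"
    "{\<sigma> \<in> odd_perms n. exc_tilde n \<sigma> = d \<and> P \<subseteq> cPEAK n \<sigma>} = {}" by auto
  then show ?thesis by (metis card.empty)
next
  case True
  then have f: "functional P" and s: "peak_letters P \<subseteq> {1..n}" by auto
  interpret marked_peaks "peak_letters P" "peak_nbrs P" .
  \<comment> \<open>Since \<open>asc + des = n - 1\<close>, \<open>des = d\<close> means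
    \<open>ht + 1 = k\<close>; by \<open>total_turn_exc_tilde\<close>, \<open>exc_tilde = d\<close>
    means \<open>total_turn = k\<close>.\<close>
  define k where "k = int n - 2 * int d"
  have "{\<sigma> \<in> odd_perms n. exc_tilde n \<sigma> = d \<and> P \<subseteq> cPEAK n \<sigma>} =
      {\<sigma> \<in> cperms {1..n}. total_turn \<sigma> {1..n} = k}"
  proof -
    have "\<sigma> \<in> odd_perms n \<and> P \<subseteq> cPEAK n \<sigma> \<longleftrightarrow> \<sigma> \<in> cperms {1..n}" for \<sigma>
      using peaks_ok_cPEAK[OF f s, of \<sigma>] by (auto simp: odd_perms_def cycles_def cperms_def perms_def)
    moreover have "exc_tilde n \<sigma> = d \<longleftrightarrow> total_turn \<sigma> {1..n} = k" if "\<sigma> \<in> odd_perms n" for \<sigma>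
      using total_turn_exc_tilde[OF that] unfolding k_def by linarith
    ultimately show ?thesis by blast
  qed
  moreover have "card {p \<in> ballot n. des n p = d \<and> P \<subseteq> PEAK n p} =
      card {w \<in> ballots {1..n}. ht w + 1 = k}"
  proof (rule bij_betw_same_card)
    have eq: "p \<in> ballot n \<and> des n p = d \<and> P \<subseteq> PEAK n p \<longleftrightarrow>
        word_of n p \<in> ballots {1..n} \<and> ht (word_of n p) + 1 = k" if p: "p \<in> perms n" for p
    proof -
      have "distinct (word_of n p) \<and> set (word_of n p) = {1..n}"
        using bij_betwE[OF bij_betw_word_of] p by blast
      moreover have "des n p = d \<longleftrightarrow> ht (word_of n p) + 1 = k"
        using ht_word_of[OF p, of n] assms unfolding k_def by linarith
      ultimately show ?thesis
        using good_word_of[OF p f s] starts_min_word_of[OF p] p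
        by (auto simp: ballots_def words_def ballot_def)
    qed
    show "bij_betw (word_of n) {p \<in> ballot n. des n p = d \<and> P \<subseteq> PEAK n p}
        {w \<in> ballots {1..n}. ht w + 1 = k}"
      unfolding bij_betw_def
    proof
      show "inj_on (word_of n) {p \<in> ballot n. des n p = d \<and> P \<subseteq> PEAK n p}"
        by (rule inj_on_subset[OF bij_betw_imp_inj_on[OF bij_betw_word_of]]) (auto simp: ballot_def)
      show "word_of n ` {p \<in> ballot n. des n p = d \<and> P \<subseteq> PEAK n p} = {w \<in> ballots {1..n}. ht w + 1 = k}"
      proof
        show "word_of n ` {p \<in> ballot n. des n p = d \<and> P \<subseteq> PEAK n p} \<subseteq> {w \<in> ballots {1..n}. ht w + 1 = k}"
          using eq by (auto simp: ballot_def)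
        show "{w \<in> ballots {1..n}. ht w + 1 = k} \<subseteq> word_of n ` {p \<in> ballot n. des n p = d \<and> P \<subseteq> PEAK n p}"
        proof
          fix w assume w: "w \<in> {w \<in> ballots {1..n}. ht w + 1 = k}"
          then have "w \<in> word_of n ` perms n"
            using bij_betw_imp_surj_on[OF bij_betw_word_of] by (auto simp: ballots_def words_def)
          then obtain p where "p \<in> perms n" "w = word_of n p" by blast
          then show "w \<in> word_of n ` {p \<in> ballot n. des n p = d \<and> P \<subseteq> PEAK n p}"
            using eq[of p] w by blast
        qed
      qed
    qed
  qed
  ultimately show ?thesis using card_cperms_eq_ballots[of "{1..n}" k] assms by simp
qed

theorem theorem1p3:
  fixes n :: nat and t :: "'a :: comm_semiring_1"
  assumes "n \<ge> 1"
  shows "(\<exists>\<Psi>. bij_betw \<Psi> (ballot n) (odd_perms n) \<and>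
            (\<forall>p \<in> ballot n. des n p = exc_tilde n (\<Psi> p) \<and> PEAK n p = cPEAK n (\<Psi> p)))
         \<and> (\<Sum>p \<in> ballot n. t ^ des n p) = (\<Sum>s \<in> odd_perms n. t ^ exc_tilde n s)"
proof -
  have fp: "finite (perms n)" unfolding perms_def by (rule finite_permutations) simp
  have fin: "finite (ballot n)" "finite (odd_perms n)"
    using fp by (auto simp: ballot_def odd_perms_def)
  have fPEAK: "finite (PEAK n p)" for p
    by (rule finite_subset[of _ "(\<lambda>l. (p l, {p (l - 1), p (Suc l)})) ` {..n}"]) (auto simp: PEAK_def)
  have fcPEAK: "finite (cPEAK n \<sigma>)" for \<sigma>
    by (rule finite_subset[of _ "(\<lambda>k. (k, {inv \<sigma> k, \<sigma> k})) ` {1..n}"]) (auto simp: cPEAK_def)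
  \<comment> \<open>Equal joint fibres of the two pairs of statistics suffice for the bijection. The
    number \<open>d\<close> is fixed first, and the peak set is then made exact from the superset
    counts.\<close>
  have "card {p \<in> ballot n. (des n p, PEAK n p) = k} =
      card {\<sigma> \<in> odd_perms n. (exc_tilde n \<sigma>, cPEAK n \<sigma>) = k}" for k
  proof -
    obtain d P where k: "k = (d, P)" by force
    have "card {p \<in> {p \<in> ballot n. des n p = d}. PEAK n p = P} =
        card {\<sigma> \<in> {\<sigma> \<in> odd_perms n. exc_tilde n \<sigma> = d}. cPEAK n \<sigma> = P}"
    proof (rule exact_from_superset_counts)
      show "card {p \<in> {p \<in> ballot n. des n p = d}. P \<subseteq> PEAK n p} =
          card {\<sigma> \<in> {\<sigma> \<in> odd_perms n. exc_tilde n \<sigma> = d}. P \<subseteq> cPEAK n \<sigma>}" for P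
        using card_superset_counts[OF assms, of d P] by (simp add: conj_assoc)
    qed (use fin fPEAK fcPEAK in auto)
    then show ?thesis by (simp add: k conj_assoc)
  qed
  from bij_betw_from_fibre_cards[OF fin this]
  obtain \<Psi> where b: "bij_betw \<Psi> (ballot n) (odd_perms n)"
    and \<Psi>: "\<And>p. p \<in> ballot n \<Longrightarrow> (exc_tilde n (\<Psi> p), cPEAK n (\<Psi> p)) = (des n p, PEAK n p)"
    by blast
  have "(\<Sum>p\<in>ballot n. t ^ des n p) = (\<Sum>p\<in>ballot n. t ^ exc_tilde n (\<Psi> p))"
    using \<Psi> by (intro sum.cong) auto
  also have "\<dots> = (\<Sum>s\<in>odd_perms n. t ^ exc_tilde n s)"
    by (rule sum.reindex_bij_betw[OF b])
  finally show ?thesis using b \<Psi> by auto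
qed

end
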